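(* Let $\mathcal{A}$ be a sign pattern of order $n$, and let $A=[a_{ij}]\in Q(\mathcal{A})$ be a nilpotent matrix that allows a full-rank Jacobian. Suppose that for some index $k\in\{1,\dots,n\}$ and some index $v\in\{1,\dots,n\}$ with $v\neq k$ we have $a_{kk}\neq 0$, $a_{kv}\neq 0$ and $\det A(k,v)\neq 0$. Let $B$ be the matrix of order $n+1$ $$B=\left[\begin{array}{c|c} A-a_{kk}P_{kk} & \mathbf{e}_k\\ \hline a_{kk}\, r_k(A-a_{kk}P_{kk}) & a_{kk}\end{array}\right].$$ Then $B$ is a nilpotent matrix that allows a full-rank Jacobian, and hence every superpattern of $\mathcal{B}=\operatorname{sgn}(B)$ is spectrally arbitrary.
   Context: All matrices are real. A sign pattern of order $n$ is an $n\times n$ matrix $\mathcal{A}=[\alpha_{ij}]$ with entries in $\{0,+,-\}$. $Q(\mathcal{A})$ is the set of real $n\times n$ matrices $A=[a_{ij}]$ with $a_{ij}=0$ if $\alpha_{ij}=0$, $a_{ij}>0$ if $\alpha_{ij}=+$, and $a_{ij}<0$ if $\alpha_{ij}=-$. If $A\in Q(\mathcal{A})$, write $\operatorname{sgn}(A)=\mathcal{A}$. A pattern $\mathcal{B}=[\beta_{ij}]$ is a superpattern of $\mathcal{A}=[\alpha_{ij}]$ (of the same order) if $\alpha_{ij}\neq 0$ implies $\beta_{ij}=\alpha_{ij}$. The characteristic polynomial of $A$ is $p_A(z)=\det(zI-A)$. A sign pattern $\mathcal{A}$ of order $n$ is spectrally arbitrary if for every monic real polynomial $p(z)$ of degree $n$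 there is a matrix $A\in Q(\mathcal{A})$ with $p_A(z)=p(z)$. Full-rank Jacobian: let $A$ be a matrix of order $n$. Choose $m\ge n$ nonzero entries $a_{i_1j_1},\dots,a_{i_mj_m}$ of $A$ and let $X=X_A(x_1,\dots,x_m)$ be obtained from $A$ by replacing $a_{i_kj_k}$ with a variable $x_k$ for $k=1,\dots,m$ (all other entries are kept fixed). Write $p_X(z)=z^n+f_1z^{n-1}+\cdots+f_{n-1}z+f_n$ with $f_i=f_i(x_1,\dots,x_m)$, and let $J_{X=A}$ be the $n\times m$ matrix with $(i,j)$ entry $\partial f_i/\partial x_j$ evaluated at $(x_1,\dots,x_m)=(a_{i_1j_1},\dots,a_{i_mj_m})$. The nilpotent matrix $A$ allows a full-rank Jacobian if, for some such choice of entries, $J_{X=A}$ has rank $n$. Notation: $r_k(M)$ is the $k$th row of $M$; $P_{kk}$ is the $n\times n$ matrix with a $1$ in entry $(k,k)$ and zeros elsewhere; $\mathbf{e}_k\in\mathbb{R}^n$ is the $k$th standard unit column vector; $A(u,v)$ is the matrix obtained from $A$ by deleting row $u$ and column $v$. *)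

theory Defs
  imports
    "HOL-Analysis.Analysis"
    "Jordan_Normal_Form.Char_Poly"
    "Jordan_Normal_Form.DL_Rank"
begin

text \<open>All row and column indices are 0-based: the indices 1, ..., n of the mathematical text
  are the naturals below n here.\<close>

datatype sign_entry = SZero | SPos | SNeg

type_synonym sign_pattern = "sign_entry mat"

fun has_sign :: "real \<Rightarrow> sign_entry \<Rightarrow> bool" where
  "has_sign x SZero \<longleftrightarrow> x = 0"
| "has_sign x SPos \<longleftrightarrow> x > 0"
| "has_sign x SNeg \<longleftrightarrow> x < 0"

text \<open>The set Q of a pattern.\<close>

definition qual_class :: "sign_pattern \<Rightarrow> real mat set" where
  "qual_class S = {A \<in> carrier_mat (dim_row S) (dim_col S).
     \<forall>i < dim_row S. \<forall>j < dim_col S. has_sign (A $$ (i, j)) (S $$ (i, j))}"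

definition sign_of :: "real \<Rightarrow> sign_entry" where
  "sign_of x = (if x = 0 then SZero else if x > 0 then SPos else SNeg)"

definition sgn_mat :: "real mat \<Rightarrow> sign_pattern" where
  "sgn_mat A = map_mat sign_of A"

definition superpattern :: "sign_pattern \<Rightarrow> sign_pattern \<Rightarrow> bool" where
  "superpattern T S \<longleftrightarrow> T \<in> carrier_mat (dim_row S) (dim_col S) \<and>
     (\<forall>i < dim_row S. \<forall>j < dim_col S. S $$ (i, j) \<noteq> SZero \<longrightarrow> T $$ (i, j) = S $$ (i, j))"

definition spectrally_arbitrary :: "sign_pattern \<Rightarrow> bool" where
  "spectrally_arbitrary S \<longleftrightarrow> square_mat S \<and>
     (\<forall>p :: real poly. monic p \<and> degree p = dim_row S \<longrightarrow>
        (\<exists>A \<in> qual_class S. char_poly A = p))"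

definition nilpotent_mat :: "real mat \<Rightarrow> bool" where
  "nilpotent_mat A \<longleftrightarrow> square_mat A \<and> (\<exists>m. A ^\<^sub>m m = 0\<^sub>m (dim_row A) (dim_row A))"

text \<open>The matrix X: the entry of A at position \<open>ps ! l\<close> is replaced by \<open>xs ! l\<close>, and all
  other entries are kept. Used for distinct \<open>ps\<close> and \<open>xs\<close> of the same length.\<close>

definition subst_entries :: "real mat \<Rightarrow> (nat \<times> nat) list \<Rightarrow> real list \<Rightarrow> real mat" where
  "subst_entries A ps xs = mat (dim_row A) (dim_col A)
     (\<lambda>p. case map_of (zip ps xs) p of None \<Rightarrow> A $$ p | Some x \<Rightarrow> x)"

text \<open>Entry (i, j) of the Jacobian is the partial derivative with respect to the j-th variable of
  the coefficient of \<open>z ^ (n - 1 - i)\<close>, i.e. of the coefficient f with index i + 1, evaluated at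
  the original entries of A.\<close>

definition jacobian_at :: "real mat \<Rightarrow> (nat \<times> nat) list \<Rightarrow> real mat" where
  "jacobian_at A ps =
    (let n = dim_row A; as = map (\<lambda>p. A $$ p) ps in
     mat n (length ps) (\<lambda>(i, j).
       deriv (\<lambda>t. coeff (char_poly (subst_entries A ps (as[j := t]))) (n - Suc i)) (as ! j)))"

definition allows_full_rank_jacobian :: "real mat \<Rightarrow> bool" where
  "allows_full_rank_jacobian A \<longleftrightarrow> (\<exists>ps.
     distinct ps \<and> dim_row A \<le> length ps \<and>
     (\<forall>(i, j) \<in> set ps. i < dim_row A \<and> j < dim_col A \<and> A $$ (i, j) \<noteq> 0) \<and>
     vec_space.rank (dim_row A) (jacobian_at A ps) = dim_row A)"

definition unit_diag :: "nat \<Rightarrow> nat \<Rightarrow> real mat" where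
  "unit_diag n k = mat n n (\<lambda>(i, j). if i = k \<and> j = k then 1 else 0)"

definition bordered_mat :: "nat \<Rightarrow> nat \<Rightarrow> real mat \<Rightarrow> real mat" where
  "bordered_mat n k A =
    (let a = A $$ (k, k); A' = A - a \<cdot>\<^sub>m unit_diag n k in
     four_block_mat
       A'                                  (mat_of_cols n [unit_vec n k])
       (mat_of_rows n [a \<cdot>\<^sub>v row A' k])    (mat 1 1 (\<lambda>_. a)))"

end

theory Submission
  imports Defs
begin

text \<open>
  Let a be the entry of A at (k, k), and let e be the k-th unit row vector. Conjugating B by the
  unipotent matrix with lower left block a e gives a block triangular matrix with diagonal blocks A and 0. Hence B is
  nilpotent (nilpotent_bordered_mat) and its characteristic polynomial is z times that of A
  (char_poly_bordered_mat). This identity holds for all matrices A, so it may be differentiated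
  with respect to the entries of A.

  A full-rank Jacobian means that the derivatives of the characteristic polynomial at the nonzero
  positions of A span all polynomials of degree less than n (allows_full_rank_jacobian_iff). The
  differentiated identity expresses z times each of these as a combination of such derivatives for B
  (reachable_bordered), so those of B span all multiples of z of degree at most n. The derivative with
  respect to the entry (n, v) of B has a nonzero constant term because the minor of A without row
  k and column v is nonzero
  (coeff_0_entry_deriv_bordered). This one extra polynomial makes the span complete
  (full_rank_jacobian_bordered).

  The last conclusion is the nilpotent-Jacobian method (nilpotent_jacobian_superpattern). A nilpotent
  matrix has characteristic polynomial z^N, and surjectivity of the differential makes it possible to
  reach all nearby monic polynomials with small changes of the nonzero entries, even after small
  entries have been placed at other positions (local_solvability, proved by a
  simplified Newton iteration). Positive scaling then reaches every monic polynomial.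
\<close>

section \<open>The characteristic polynomial as a function of the entries\<close>

text \<open>The partial derivative of the characteristic polynomial with respect to the entry in row i
  and column j; the sign comes from the entries of A being subtracted from zI.\<close>
definition entry_deriv :: "real mat \<Rightarrow> nat \<Rightarrow> nat \<Rightarrow> real poly" where
  "entry_deriv A i j = - cofactor (char_poly_matrix A) i j"

lemma char_poly_matrix_index:
  assumes "A \<in> carrier_mat n n" "i < n" "j < n"
  shows "char_poly_matrix A $$ (i, j) = (if i = j then [:0, 1:] else 0) - [:A $$ (i, j):]"
  using assms by (auto simp: char_poly_matrix_def)

text \<open>The determinant is linear in each column, so the first-order expansion of the
  characteristic polynomial is exact as long as only one column moves. The cofactors along that
  column do not see the change.\<close>
lemma char_poly_change_column:
  assumes A: "A \<in> carrier_mat n n" and A': "A' \<in> carrier_mat n n" and j: "j < n"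
    and same: "\<And>i l. i < n \<Longrightarrow> l < n \<Longrightarrow> l \<noteq> j \<Longrightarrow> A' $$ (i, l) = A $$ (i, l)"
  shows "char_poly A' = char_poly A + (\<Sum>i<n. Polynomial.smult (A' $$ (i, j) - A $$ (i, j)) (entry_deriv A i j))"
proof -
  have cof: "cofactor (char_poly_matrix A') i j = cofactor (char_poly_matrix A) i j" if "i < n" for i
  proof -
    have "mat_delete (char_poly_matrix A') i j = mat_delete (char_poly_matrix A) i j"
      unfolding mat_delete_def
      by (rule cong_mat) (use A A' same j in \<open>auto simp: char_poly_matrix_def\<close>)
    then show ?thesis by (simp add: cofactor_def)
  qed
  have expand: "char_poly M = (\<Sum>i<n. char_poly_matrix M $$ (i, j) * cofactor (char_poly_matrix A) i j)"
    if "M = A \<or> M = A'" for M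
    unfolding char_poly_def
    by (subst laplace_expansion_column[where j = j, OF char_poly_matrix_closed j])
       (use that A A' cof j in \<open>auto intro!: sum.cong\<close>)
  have entry: "(char_poly_matrix A' $$ (i, j) - char_poly_matrix A $$ (i, j)) * q =
      Polynomial.smult (A' $$ (i, j) - A $$ (i, j)) (- q)" if "i < n" for i q
  proof -
    have "char_poly_matrix A' $$ (i, j) - char_poly_matrix A $$ (i, j) = [:- (A' $$ (i, j) - A $$ (i, j)):]"
      using that j by (simp add: char_poly_matrix_index[OF A] char_poly_matrix_index[OF A'])
    then show ?thesis by (simp only: mult_pCons_left smult_minus_left smult_minus_right mult_zero_left pCons_0_0 add_0_right)
  qed
  have "char_poly A' - char_poly A = (\<Sum>i<n. (char_poly_matrix A' $$ (i, j) - char_poly_matrix A $$ (i, j))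
      * cofactor (char_poly_matrix A) i j)"
    by (simp only: expand[of A] expand[of A'] simp_thms sum_subtractf[symmetric] left_diff_distrib)
  also have "\<dots> = (\<Sum>i<n. Polynomial.smult (A' $$ (i, j) - A $$ (i, j)) (entry_deriv A i j))"
    by (rule sum.cong) (auto simp only: entry_deriv_def entry lessThan_iff)
  finally show ?thesis by (simp add: algebra_simps)
qed

lemma char_poly_change_row:
  assumes A: "A \<in> carrier_mat n n" and A': "A' \<in> carrier_mat n n" and i: "i < n"
    and same: "\<And>l j. l < n \<Longrightarrow> j < n \<Longrightarrow> l \<noteq> i \<Longrightarrow> A' $$ (l, j) = A $$ (l, j)"
  shows "char_poly A' = char_poly A + (\<Sum>j<n. Polynomial.smult (A' $$ (i, j) - A $$ (i, j)) (entry_deriv A i j))"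
proof -
  have cof: "cofactor (char_poly_matrix A') i j = cofactor (char_poly_matrix A) i j" if "j < n" for j
  proof -
    have "mat_delete (char_poly_matrix A') i j = mat_delete (char_poly_matrix A) i j"
      unfolding mat_delete_def
      by (rule cong_mat) (use A A' same i in \<open>auto simp: char_poly_matrix_def\<close>)
    then show ?thesis by (simp add: cofactor_def)
  qed
  have expand: "char_poly M = (\<Sum>j<n. char_poly_matrix M $$ (i, j) * cofactor (char_poly_matrix A) i j)"
    if "M = A \<or> M = A'" for M
    unfolding char_poly_def
    by (subst laplace_expansion_row[where i = i, OF char_poly_matrix_closed i])
       (use that A A' cof i in \<open>auto intro!: sum.cong\<close>)
  have entry: "(char_poly_matrix A' $$ (i, j) - char_poly_matrix A $$ (i, j)) * q =
      Polynomial.smult (A' $$ (i, j) - A $$ (i, j)) (- q)" if "j < n" for j q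
  proof -
    have "char_poly_matrix A' $$ (i, j) - char_poly_matrix A $$ (i, j) = [:- (A' $$ (i, j) - A $$ (i, j)):]"
      using that i by (simp add: char_poly_matrix_index[OF A] char_poly_matrix_index[OF A'])
    then show ?thesis by (simp only: mult_pCons_left smult_minus_left smult_minus_right mult_zero_left pCons_0_0 add_0_right)
  qed
  have "char_poly A' - char_poly A = (\<Sum>j<n. (char_poly_matrix A' $$ (i, j) - char_poly_matrix A $$ (i, j))
      * cofactor (char_poly_matrix A) i j)"
    by (simp only: expand[of A] expand[of A'] simp_thms sum_subtractf[symmetric] left_diff_distrib)
  also have "\<dots> = (\<Sum>j<n. Polynomial.smult (A' $$ (i, j) - A $$ (i, j)) (entry_deriv A i j))"
    by (rule sum.cong) (auto simp only: entry_deriv_def entry lessThan_iff)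
  finally show ?thesis by (simp add: algebra_simps)
qed

lemma char_poly_change_entry:
  assumes A: "A \<in> carrier_mat n n" and A': "A' \<in> carrier_mat n n" and ij: "i < n" "j < n"
    and same: "\<And>k l. k < n \<Longrightarrow> l < n \<Longrightarrow> (k, l) \<noteq> (i, j) \<Longrightarrow> A' $$ (k, l) = A $$ (k, l)"
  shows "char_poly A' = char_poly A + Polynomial.smult (A' $$ (i, j) - A $$ (i, j)) (entry_deriv A i j)"
proof -
  have "(\<Sum>l<n. Polynomial.smult (A' $$ (i, l) - A $$ (i, l)) (entry_deriv A i l)) =
      (\<Sum>l<n. if l = j then Polynomial.smult (A' $$ (i, j) - A $$ (i, j)) (entry_deriv A i j) else 0)"
    by (rule sum.cong) (use same ij in auto)
  with char_poly_change_row[OF A A' ij(1)] same ij show ?thesis by auto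
qed

lemma coeff_entry_deriv_eq_0:
  assumes A: "A \<in> carrier_mat n n" and ij: "i < n" "j < n" and "n \<le> r"
  shows "coeff (entry_deriv A i j) r = 0"
proof -
  define A' where "A' = mat n n (\<lambda>p. A $$ p + (if p = (i, j) then 1 else 0))"
  have A': "A' \<in> carrier_mat n n" by (simp add: A'_def)
  have "char_poly A' = char_poly A + entry_deriv A i j"
    using char_poly_change_entry[OF A A' ij] ij by (simp add: A'_def)
  moreover have "coeff (char_poly M) r = (if r = n then 1 else 0)" if "M \<in> carrier_mat n n" for M :: "real mat"
    using degree_monic_char_poly[OF that] \<open>n \<le> r\<close> by (auto intro: coeff_eq_0)
  ultimately show ?thesis using A A' by (metis add_cancel_right_right coeff_add)
qed

section \<open>Full-rank Jacobians as surjective differentials\<close>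

text \<open>The directional derivatives of the characteristic polynomial at A along matrices supported
  on the nonzero positions of A, i.e. the image of the differential that the Jacobian represents in
  coordinates.\<close>
definition reachable :: "real mat \<Rightarrow> real poly \<Rightarrow> bool" where
  "reachable A q \<longleftrightarrow> (\<exists>D :: nat \<times> nat \<Rightarrow> real. (\<forall>p. A $$ p = 0 \<longrightarrow> D p = 0) \<and>
     q = (\<Sum>(i, j)\<in>{..<dim_row A} \<times> {..<dim_row A}. Polynomial.smult (D (i, j)) (entry_deriv A i j)))"

lemma reachable_0: "reachable A 0"
  unfolding reachable_def by (rule exI[of _ "\<lambda>_. 0"]) simp

lemma reachable_add:
  assumes "reachable A q" "reachable A r"
  shows "reachable A (q + r)"
proof -
  from assms obtain D E where D: "\<forall>p. A $$ p = 0 \<longrightarrow> D p = 0" and E: "\<forall>p. A $$ p = 0 \<longrightarrow> E p = 0"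
    and "q = (\<Sum>(i, j)\<in>{..<dim_row A} \<times> {..<dim_row A}. Polynomial.smult (D (i, j)) (entry_deriv A i j))"
    "r = (\<Sum>(i, j)\<in>{..<dim_row A} \<times> {..<dim_row A}. Polynomial.smult (E (i, j)) (entry_deriv A i j))"
    unfolding reachable_def by auto
  then have "q + r = (\<Sum>(i, j)\<in>{..<dim_row A} \<times> {..<dim_row A}.
      Polynomial.smult (D (i, j) + E (i, j)) (entry_deriv A i j))"
    by (simp add: smult_add_left case_prod_unfold sum.distrib)
  then show ?thesis unfolding reachable_def
    using D E by (intro exI[of _ "\<lambda>p. D p + E p"]) simp
qed

lemma reachable_smult:
  assumes "reachable A q"
  shows "reachable A (Polynomial.smult c q)"
proof -
  from assms obtain D where D: "\<forall>p. A $$ p = 0 \<longrightarrow> D p = 0"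
    "q = (\<Sum>(i, j)\<in>{..<dim_row A} \<times> {..<dim_row A}. Polynomial.smult (D (i, j)) (entry_deriv A i j))"
    unfolding reachable_def by auto
  show ?thesis unfolding reachable_def D(2)
    by (rule exI[of _ "\<lambda>p. c * D p"]) (auto simp: D(1) smult_sum2 intro!: sum.cong)
qed

lemma reachable_sum:
  assumes "\<And>x. x \<in> I \<Longrightarrow> reachable A (q x)"
  shows "reachable A (\<Sum>x\<in>I. q x)"
  using assms by (induction I rule: infinite_finite_induct) (auto intro: reachable_0 reachable_add)

lemma reachable_entry_deriv:
  assumes "i < dim_row A" "j < dim_row A" "A $$ (i, j) \<noteq> 0"
  shows "reachable A (entry_deriv A i j)"
proof -
  have "(\<Sum>(k, l)\<in>{..<dim_row A} \<times> {..<dim_row A}.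
        Polynomial.smult (if (k, l) = (i, j) then 1 else 0) (entry_deriv A k l)) =
      (\<Sum>p\<in>{..<dim_row A} \<times> {..<dim_row A}. if p = (i, j) then entry_deriv A i j else 0)"
    by (rule sum.cong) auto
  with assms show ?thesis unfolding reachable_def
    by (intro exI[of _ "\<lambda>p. if p = (i, j) then 1 else 0"]) auto
qed

text \<open>A maximal independent set of columns with n elements is a basis of the whole space, so
  the column space is everything.\<close>
lemma rank_eq_dim_iff_surj:
  fixes M :: "real mat"
  assumes M: "M \<in> carrier_mat n m"
  shows "vec_space.rank n M = n \<longleftrightarrow> (\<forall>b\<in>carrier_vec n. \<exists>x\<in>carrier_vec m. M *\<^sub>v x = b)"
proof -
  interpret vec_space "TYPE(real)" n .
  have cols: "set (cols M) \<subseteq> carrier_vec n" using M cols_dim by blast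
  have col_space: "span (set (cols M)) = {b \<in> carrier_vec n. \<exists>x\<in>carrier_vec m. M *\<^sub>v x = b}"
    using col_space_eq[OF M] M unfolding col_space_def by auto
  have "rank M = n \<longleftrightarrow> span (set (cols M)) = carrier_vec n"
  proof
    assume rk: "rank M = n"
    obtain U where U: "finite U" "maximal U (\<lambda>T. T \<subseteq> set (cols M) \<and> lin_indpt T)"
      using maximal_exists_superset[of "set (cols M)" "\<lambda>T. T \<subseteq> set (cols M) \<and> lin_indpt T" "{}"]
      by (auto simp: lin_dep_def)
    have "card U = n" using rank_card_indpt[OF M U(2)] rk by simp
    moreover have UM: "U \<subseteq> set (cols M)" "lin_indpt U" using U(2) by (auto simp: maximal_def)
    ultimately have "basis U"
      using cols U(1) by (intro dim_li_is_basis) (auto simp: dim_is_n)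
    then have "span U = carrier_vec n" by (simp add: basis_def)
    moreover have "span U \<subseteq> span (set (cols M))" by (rule span_is_monotone[OF UM(1)])
    moreover have "span (set (cols M)) \<subseteq> carrier_vec n" using span_closed[OF cols] by auto
    ultimately show "span (set (cols M)) = carrier_vec n" by auto
  next
    assume sp: "span (set (cols M)) = carrier_vec n"
    have "vs (carrier_vec n) = V" by (simp add: module_vec_def)
    then show "rank M = n" unfolding rank_def sp using dim_is_n by (simp only:)
  qed
  then show ?thesis unfolding col_space by auto
qed

text \<open>Only one entry varies, so the coefficient is an affine function of t, with slope given by
  the cofactor.\<close>
lemma jacobian_at_index:
  assumes A: "A \<in> carrier_mat n n" and ps: "distinct ps"
    and i: "i < n" and l: "l < length ps" and pl: "ps ! l = (k, j)" and kj: "k < n" "j < n"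
  shows "jacobian_at A ps $$ (i, l) = coeff (entry_deriv A k j) (n - Suc i)"
proof -
  let ?as = "map (\<lambda>p. A $$ p) ps"
  have sub: "subst_entries A ps (?as[l := t]) =
      mat n n (\<lambda>p. if p = (k, j) then t else A $$ p)" for t
  proof -
    have "(case map_of (zip ps (?as[l := t])) p of None \<Rightarrow> A $$ p | Some x \<Rightarrow> x) =
        (if p = (k, j) then t else A $$ p)" for p
    proof (cases "p \<in> set ps")
      case True
      then obtain s where s: "s < length ps" "ps ! s = p" by (auto simp: in_set_conv_nth)
      have "map_of (zip ps (?as[l := t])) (ps ! s) = Some ((?as[l := t]) ! s)"
        by (rule map_of_zip_nth) (use s ps in auto)
      then have "(case map_of (zip ps (?as[l := t])) p of None \<Rightarrow> A $$ p | Some x \<Rightarrow> x) = (?as[l := t]) ! s"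
        using s(2) by (simp only: option.case)
      moreover have "(s = l) = (p = (k, j))"
        using nth_eq_iff_index_eq[OF ps s(1) l] s(2) pl by simp
      ultimately show ?thesis using s l by (auto simp: nth_list_update)
    next
      case False
      then have "map_of (zip ps (?as[l := t])) p = None"
        by (simp only: map_of_zip_is_None length_list_update length_map simp_thms)
      moreover have "p \<noteq> (k, j)" using False pl nth_mem[OF l] by auto
      ultimately show ?thesis by (simp only: option.case if_False)
    qed
    then show ?thesis using A unfolding subst_entries_def by (intro cong_mat) auto
  qed
  have "coeff (char_poly (subst_entries A ps (?as[l := t]))) r =
      coeff (char_poly A) r + (t - A $$ (k, j)) * coeff (entry_deriv A k j) r" for t r
  proof -
    have "char_poly (subst_entries A ps (?as[l := t])) = char_poly A +
        Polynomial.smult (mat n n (\<lambda>p. if p = (k, j) then t else A $$ p) $$ (k, j) - A $$ (k, j))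
          (entry_deriv A k j)"
      unfolding sub by (rule char_poly_change_entry[OF A _ kj]) auto
    then show ?thesis using kj by simp
  qed
  then have "((\<lambda>t. coeff (char_poly (subst_entries A ps (?as[l := t]))) (n - Suc i)) has_field_derivative
      coeff (entry_deriv A k j) (n - Suc i)) (at (?as ! l))"
    by (simp only:) (auto intro!: derivative_eq_intros)
  then have "deriv (\<lambda>t. coeff (char_poly (subst_entries A ps (?as[l := t]))) (n - Suc i)) (?as ! l) =
      coeff (entry_deriv A k j) (n - Suc i)"
    by (rule DERIV_imp_deriv)
  then show ?thesis using A i l by (simp add: jacobian_at_def Let_def)
qed

text \<open>The choice of positions disappears: adding positions only adds columns to the
  Jacobian, so one may take all nonzero positions, and full rank becomes the statement that every
  polynomial of degree less than n is a directional derivative.\<close>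
lemma allows_full_rank_jacobian_iff:
  assumes A: "A \<in> carrier_mat n n" and "n > 0"
  shows "allows_full_rank_jacobian A \<longleftrightarrow> (\<forall>q. degree q < n \<longrightarrow> reachable A q)"
proof
  assume "allows_full_rank_jacobian A"
  then obtain ps where ps: "distinct ps" "\<And>i j. (i, j) \<in> set ps \<Longrightarrow> i < n \<and> j < n \<and> A $$ (i, j) \<noteq> 0"
    and rk: "vec_space.rank n (jacobian_at A ps) = n"
    using A unfolding allows_full_rank_jacobian_def by (simp only: carrier_matD) blast
  define m where "m = length ps"
  have J: "jacobian_at A ps \<in> carrier_mat n m" using A by (simp add: jacobian_at_def Let_def m_def)
  have psl: "fst (ps ! l) < n \<and> snd (ps ! l) < n \<and> A $$ (ps ! l) \<noteq> 0" if "l < m" for l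
    using ps(2)[of "fst (ps ! l)" "snd (ps ! l)"] that nth_mem[of l ps] by (auto simp: m_def)
  show "\<forall>q. degree q < n \<longrightarrow> reachable A q"
  proof (intro allI impI)
    fix q :: "real poly" assume q: "degree q < n"
    obtain x where x: "x \<in> carrier_vec m"
      "jacobian_at A ps *\<^sub>v x = vec n (\<lambda>i. coeff q (n - Suc i))"
      using rk vec_carrier[of n "\<lambda>i. coeff q (n - Suc i)"] unfolding rank_eq_dim_iff_surj[OF J] by blast
    have "q = (\<Sum>l<m. Polynomial.smult (x $ l) (entry_deriv A (fst (ps ! l)) (snd (ps ! l))))" (is "q = ?r")
    proof (rule poly_eqI)
      fix r
      show "coeff q r = coeff ?r r"
      proof (cases "r < n")
        case True
        define i where "i = n - Suc r"
        have i: "i < n" "n - Suc i = r" using True by (auto simp: i_def)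
        have "coeff q r = (jacobian_at A ps *\<^sub>v x) $ i" using i by (simp add: x)
        also have "\<dots> = (\<Sum>l<m. jacobian_at A ps $$ (i, l) * x $ l)"
          using J x(1) i by (auto simp: scalar_prod_def atLeast0LessThan)
        also have "\<dots> = (\<Sum>l<m. coeff (entry_deriv A (fst (ps ! l)) (snd (ps ! l))) r * x $ l)"
        proof (rule sum.cong[OF refl])
          fix l assume "l \<in> {..<m}"
          then have lm: "l < m" by (rule lessThan_iff[THEN iffD1])
          have l: "l < length ps" "fst (ps ! l) < n" "snd (ps ! l) < n"
            using lm psl[OF lm] by (simp_all only: m_def)
          show "jacobian_at A ps $$ (i, l) * x $ l = coeff (entry_deriv A (fst (ps ! l)) (snd (ps ! l))) r * x $ l"
            using jacobian_at_index[OF A ps(1) i(1) l(1) prod.collapse[symmetric] l(2,3)] i(2) by (simp only:)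
        qed
        also have "\<dots> = coeff ?r r" by (simp add: coeff_sum mult.commute)
        finally show ?thesis .
      next
        case False
        then have "coeff (entry_deriv A (fst (ps ! l)) (snd (ps ! l))) r = 0" if "l < m" for l
          using psl[OF that] by (intro coeff_entry_deriv_eq_0[OF A]) auto
        then have "coeff ?r r = 0" unfolding coeff_sum coeff_smult by (intro sum.neutral) simp
        moreover have "coeff q r = 0" using False q by (intro coeff_eq_0) simp
        ultimately show ?thesis by simp
      qed
    qed
    also have "reachable A ?r"
    proof (intro reachable_sum reachable_smult)
      fix l assume "l \<in> {..<m}"
      then have "l < m" by (rule lessThan_iff[THEN iffD1])
      from psl[OF this] show "reachable A (entry_deriv A (fst (ps ! l)) (snd (ps ! l)))"
        using carrier_matD(1)[OF A] by (intro reachable_entry_deriv) (simp_all add: prod.collapse)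
    qed
    finally show "reachable A q" .
  qed
next
  assume all: "\<forall>q. degree q < n \<longrightarrow> reachable A q"
  obtain ps where ps: "distinct ps" "set ps = {p \<in> {..<n} \<times> {..<n}. A $$ p \<noteq> 0}"
    using finite_distinct_list[of "{p \<in> {..<n} \<times> {..<n}. A $$ p \<noteq> 0}"] by auto
  define m where "m = length ps"
  have J: "jacobian_at A ps \<in> carrier_mat n m" using A by (simp add: jacobian_at_def Let_def m_def)
  have psl: "fst (ps ! l) < n \<and> snd (ps ! l) < n" if "l < m" for l
  proof -
    have "ps ! l \<in> set ps" using that unfolding m_def by (rule nth_mem)
    then show ?thesis unfolding ps(2) by auto
  qed
  have "\<exists>x\<in>carrier_vec m. jacobian_at A ps *\<^sub>v x = b" if b: "b \<in> carrier_vec n" for b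
  proof -
    define q where "q = (\<Sum>r<n. monom (b $ (n - Suc r)) r)"
    have coeff_q: "coeff q r = (if r < n then b $ (n - Suc r) else 0)" for r
      by (simp add: q_def coeff_sum)
    have "degree q < n" using \<open>n > 0\<close> by (intro degree_lessI) (auto simp: coeff_q)
    then have "reachable A q" using all by blast
    then obtain D where D: "\<forall>p. A $$ p = 0 \<longrightarrow> D p = 0"
      "q = (\<Sum>(i, j)\<in>{..<n} \<times> {..<n}. Polynomial.smult (D (i, j)) (entry_deriv A i j))"
      using carrier_matD(1)[OF A] unfolding reachable_def by (simp only:) blast
    define x where "x = vec m (\<lambda>l. D (ps ! l))"
    have "jacobian_at A ps *\<^sub>v x = b"
    proof (rule eq_vecI)
      show "dim_vec (jacobian_at A ps *\<^sub>v x) = dim_vec b" using J b by auto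
      fix i assume "i < dim_vec b"
      then have i: "i < n" using b by simp
      have "(jacobian_at A ps *\<^sub>v x) $ i = (\<Sum>l<m. jacobian_at A ps $$ (i, l) * x $ l)"
        using J i by (auto simp: scalar_prod_def atLeast0LessThan x_def)
      also have "\<dots> = (\<Sum>l<m. (\<lambda>p. coeff (entry_deriv A (fst p) (snd p)) (n - Suc i) * D p) (ps ! l))"
      proof (rule sum.cong[OF refl])
        fix l assume "l \<in> {..<m}"
        then have lm: "l < m" by (rule lessThan_iff[THEN iffD1])
        have l: "l < length ps" "fst (ps ! l) < n" "snd (ps ! l) < n"
          using lm psl[OF lm] by (simp_all only: m_def)
        have xl: "x $ l = D (ps ! l)" unfolding x_def by (rule index_vec[OF lm])
        show "jacobian_at A ps $$ (i, l) * x $ l = (\<lambda>p. coeff (entry_deriv A (fst p) (snd p)) (n - Suc i) * D p) (ps ! l)"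
          using jacobian_at_index[OF A ps(1) i l(1) prod.collapse[symmetric] l(2,3)] xl by (simp only:)
      qed
      also have "\<dots> = (\<Sum>p\<in>set ps. coeff (entry_deriv A (fst p) (snd p)) (n - Suc i) * D p)"
        using ps(1) by (rule sum.reindex_bij_betw[OF bij_betw_nth]) (auto simp: m_def)
      also have "\<dots> = (\<Sum>p\<in>{..<n} \<times> {..<n}. coeff (entry_deriv A (fst p) (snd p)) (n - Suc i) * D p)"
        by (rule sum.mono_neutral_left) (use ps(2) D(1) in auto)
      also have "\<dots> = coeff q (n - Suc i)"
        unfolding D(2) by (auto simp: coeff_sum intro!: sum.cong)
      also have "\<dots> = b $ i" using i by (simp add: coeff_q)
      finally show "(jacobian_at A ps *\<^sub>v x) $ i = b $ i" .
    qed
    then show ?thesis by (intro bexI[of _ x]) (auto simp: x_def)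
  qed
  then have rk: "vec_space.rank n (jacobian_at A ps) = n" using rank_eq_dim_iff_surj[OF J] by blast
  have len: "n \<le> length ps" using vec_space.rank_le_nc[OF J] rk by (simp add: m_def)
  have nz: "\<forall>(i, j)\<in>set ps. i < n \<and> j < n \<and> A $$ (i, j) \<noteq> 0" using ps(2) by auto
  show "allows_full_rank_jacobian A"
    unfolding allows_full_rank_jacobian_def carrier_matD[OF A]
  proof (rule exI[of _ ps], intro conjI)
    show "distinct ps" by (rule ps(1))
    show "n \<le> length ps" by (rule len)
    show "\<forall>(i, j)\<in>set ps. i < n \<and> j < n \<and> A $$ (i, j) \<noteq> 0" by (rule nz)
    show "vec_space.rank n (jacobian_at A ps) = n" by (rule rk)
  qed
qed

section \<open>The bordered matrix is nilpotent\<close>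

lemma bordered_mat_carrier:
  assumes "A \<in> carrier_mat n n"
  shows "bordered_mat n k A \<in> carrier_mat (n + 1) (n + 1)"
  using assms by (auto simp: bordered_mat_def Let_def unit_diag_def)

lemma bordered_mat_index:
  assumes A: "A \<in> carrier_mat n n" and k: "k < n"
  shows "i < n \<Longrightarrow> j < n \<Longrightarrow> bordered_mat n k A $$ (i, j) = (if i = k \<and> j = k then 0 else A $$ (i, j))"
    and "i < n \<Longrightarrow> bordered_mat n k A $$ (i, n) = (if i = k then 1 else 0)"
    and "j < n \<Longrightarrow> bordered_mat n k A $$ (n, j) = (if j = k then 0 else A $$ (k, k) * A $$ (k, j))"
    and "bordered_mat n k A $$ (n, n) = A $$ (k, k)"
  using A k by (auto simp: bordered_mat_def Let_def unit_diag_def mat_of_cols_def mat_of_rows_def)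

text \<open>The form that the bordered matrix takes after conjugation by a unipotent matrix; it shows
  both the spectrum and the nilpotency.\<close>
definition block_reduced :: "nat \<Rightarrow> nat \<Rightarrow> real mat \<Rightarrow> real mat" where
  "block_reduced n k A = four_block_mat A (mat n 1 (\<lambda>(i, _). if i = k then 1 else 0)) (0\<^sub>m 1 n) (0\<^sub>m 1 1)"

text \<open>Let a be the entry of A at (k, k). Adding a times the last column of the bordered matrix to its column k restores the
  entry a at position (k, k); the inverse operation on rows, which subtracts a times
  row k from the last row, then clears the last row. Both operations are given by the unipotent
  matrices L a and L (-a).\<close>
lemma bordered_mat_similar:
  assumes A: "A \<in> carrier_mat n n" and k: "k < n"
  shows "\<exists>P Q. similar_mat_wit (bordered_mat n k A) (block_reduced n k A) P Q"
proof -
  define a where "a = A $$ (k, k)"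
  define E :: "real mat" where "E = mat n 1 (\<lambda>(i, _). if i = k then 1 else 0)"
  define R where "R c = mat 1 n (\<lambda>(_, j). if j = k then c else 0)" for c :: real
  define L where "L c = four_block_mat (1\<^sub>m n) (0\<^sub>m n 1) (R c) (1\<^sub>m 1)" for c
  have car: "E \<in> carrier_mat n 1" "R c \<in> carrier_mat 1 n" "L c \<in> carrier_mat (n + 1) (n + 1)" for c
    by (auto simp: E_def R_def L_def)
  have LL: "L c * L (- c) = 1\<^sub>m (n + 1)" for c
  proof -
    have "L c * L (- c) = four_block_mat (1\<^sub>m n) (0\<^sub>m n 1) (R c + R (- c)) (1\<^sub>m 1)"
      unfolding L_def by (subst mult_four_block_mat[of _ n n _ 1 _ 1 _ _ n _ 1]) (use car(2)[of c] car(2)[of "- c"] in \<open>auto simp del: One_nat_def\<close>)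
    also have "R c + R (- c) = 0\<^sub>m 1 n" by (rule eq_matI) (auto simp: R_def)
    finally show ?thesis by (auto simp: four_block_one_mat)
  qed
  have RA: "R c * A = mat 1 n (\<lambda>(_, j). c * A $$ (k, j))" for c
  proof (rule eq_matI)
    fix i j assume ij: "i < dim_row (mat 1 n (\<lambda>(_, j). c * A $$ (k, j)))" "j < dim_col (mat 1 n (\<lambda>(_, j). c * A $$ (k, j)))"
    then have "(R c * A) $$ (i, j) = (\<Sum>l = 0..<n. (if l = k then c else 0) * A $$ (l, j))"
      using A by (auto simp: R_def scalar_prod_def)
    also have "\<dots> = (\<Sum>l = 0..<n. if l = k then c * A $$ (k, j) else 0)" by (rule sum.cong) auto
    also have "\<dots> = c * A $$ (k, j)" using k by simp
    finally show "(R c * A) $$ (i, j) = mat 1 n (\<lambda>(_, j). c * A $$ (k, j)) $$ (i, j)" using ij by simp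
  qed (use A in \<open>auto simp: R_def\<close>)
  have RE: "R c * E = mat 1 1 (\<lambda>_. c)" for c
  proof (rule eq_matI)
    fix i j assume ij: "i < dim_row (mat 1 1 (\<lambda>_. c))" "j < dim_col (mat 1 1 (\<lambda>_. c))"
    then have "(R c * E) $$ (i, j) = (\<Sum>l = 0..<n. (if l = k then c else 0) * (if l = k then 1 else 0))"
      by (auto simp: R_def E_def scalar_prod_def)
    also have "\<dots> = (\<Sum>l = 0..<n. if l = k then c else 0)" by (rule sum.cong) auto
    also have "\<dots> = c" using k by simp
    finally show "(R c * E) $$ (i, j) = mat 1 1 (\<lambda>_. c) $$ (i, j)" using ij by simp
  qed (auto simp: R_def E_def)
  have RAc: "R c * A \<in> carrier_mat 1 n" and REc: "R c * E \<in> carrier_mat 1 1" for c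
    unfolding RA RE by auto
  have C: "block_reduced n k A = four_block_mat A E (0\<^sub>m 1 n) (0\<^sub>m 1 1)"
    by (simp add: block_reduced_def E_def)
  have "L a * block_reduced n k A * L (- a) =
      four_block_mat A E (R a * A) (R a * E) * four_block_mat (1\<^sub>m n) (0\<^sub>m n 1) (R (- a)) (1\<^sub>m 1)"
    unfolding C unfolding L_def by (subst mult_four_block_mat[of _ n n _ 1 _ 1 _ _ n _ 1]) (use A car RAc REc in \<open>auto simp del: One_nat_def\<close>)
  also have "\<dots> = four_block_mat (A + E * R (- a)) E (R a * A + R a * E * R (- a)) (R a * E)"
    by (subst mult_four_block_mat[of _ n n _ 1 _ 1 _ _ n _ 1]) (use A car RAc REc in \<open>auto simp del: One_nat_def\<close>)
  also have "\<dots> = bordered_mat n k A"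
  proof (rule eq_matI)
    fix i j assume "i < dim_row (bordered_mat n k A)" "j < dim_col (bordered_mat n k A)"
    then have ij: "i < n + 1" "j < n + 1" using bordered_mat_carrier[OF A, of k] by auto
    note idx = bordered_mat_index[OF A k]
    show "four_block_mat (A + E * R (- a)) E (R a * A + R a * E * R (- a)) (R a * E) $$ (i, j)
        = bordered_mat n k A $$ (i, j)"
      unfolding RA RE using ij A car
      by (cases "i < n"; cases "j < n")
         (auto simp: less_Suc_eq idx E_def R_def scalar_prod_def a_def)
  qed (use A car bordered_mat_carrier[OF A, of k] in \<open>auto simp: E_def R_def\<close>)
  finally have "bordered_mat n k A = L a * block_reduced n k A * L (- a)" ..
  then have "similar_mat_wit (bordered_mat n k A) (block_reduced n k A) (L a) (L (- a))"
    using LL[of a] LL[of "- a"] car A bordered_mat_carrier[OF A, of k]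
    by (intro similar_mat_witI[of _ _ "n + 1"]) (auto simp: block_reduced_def)
  then show ?thesis by blast
qed

text \<open>As an identity in A, this can be differentiated with respect to the entries of A, and that
  is what relates the two Jacobians.\<close>
lemma char_poly_bordered_mat:
  assumes A: "A \<in> carrier_mat n n" and k: "k < n"
  shows "char_poly (bordered_mat n k A) = [:0, 1:] * char_poly A"
proof -
  define E :: "real mat" where "E = mat n 1 (\<lambda>(i, _). if i = k then 1 else 0)"
  have "char_poly (bordered_mat n k A) = char_poly (block_reduced n k A)"
    using bordered_mat_similar[OF A k] by (intro char_poly_similar) (auto simp: similar_mat_def)
  also have "char_poly_matrix (block_reduced n k A) = four_block_mat (char_poly_matrix A)
      (map_mat (\<lambda>a. [:- a:]) E) (0\<^sub>m 1 n) (mat 1 1 (\<lambda>_. [:0, 1:]))"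
    by (rule eq_matI) (use A in \<open>auto simp: char_poly_matrix_def block_reduced_def E_def\<close>)
  then have "char_poly (block_reduced n k A) = det (char_poly_matrix A) * det (mat 1 1 (\<lambda>_. [:0, 1:]) :: real poly mat)"
    unfolding char_poly_def
    by (simp only:) (rule det_four_block_mat_lower_left_zero[of _ n _ 1], use A in \<open>auto simp: E_def\<close>)
  also have "det (mat 1 1 (\<lambda>_. [:0, 1:]) :: real poly mat) = [:0, 1:]"
    by (subst det_single) auto
  finally show ?thesis by (simp add: char_poly_def mult.commute)
qed

text \<open>Powers of the block triangular form have the powers of A in the upper left block and a
  zero last row, so they vanish one step later than those of A.\<close>
lemma nilpotent_bordered_mat:
  assumes A: "A \<in> carrier_mat n n" and k: "k < n" and nil: "nilpotent_mat A"
  shows "nilpotent_mat (bordered_mat n k A)"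
proof -
  obtain m where m: "A ^\<^sub>m m = 0\<^sub>m n n" using nil A unfolding nilpotent_mat_def by auto
  define E :: "real mat" where "E = mat n 1 (\<lambda>(i, _). if i = k then 1 else 0)"
  have E: "E \<in> carrier_mat n 1" by (simp add: E_def)
  have C: "block_reduced n k A = four_block_mat A E (0\<^sub>m 1 n) (0\<^sub>m 1 1)"
    by (simp add: block_reduced_def E_def)
  have pow: "(block_reduced n k A) ^\<^sub>m (Suc l) = four_block_mat (A ^\<^sub>m Suc l) (A ^\<^sub>m l * E) (0\<^sub>m 1 n) (0\<^sub>m 1 1)" for l
  proof (induction l)
    case 0
    then show ?case using A E by (simp add: C)
  next
    case (Suc l)
    have Al: "A ^\<^sub>m l \<in> carrier_mat n n" using A by simp
    have "(block_reduced n k A) ^\<^sub>m Suc (Suc l) =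
        four_block_mat (A ^\<^sub>m Suc l) (A ^\<^sub>m l * E) (0\<^sub>m 1 n) (0\<^sub>m 1 1) * four_block_mat A E (0\<^sub>m 1 n) (0\<^sub>m 1 1)"
      using Suc.IH by (simp add: C)
    also have "\<dots> = four_block_mat (A ^\<^sub>m Suc (Suc l)) (A ^\<^sub>m Suc l * E) (0\<^sub>m 1 n) (0\<^sub>m 1 1)"
      by (subst mult_four_block_mat[of _ n n _ 1 _ 1 _ _ n _ 1]) (use A E Al in \<open>auto simp del: One_nat_def\<close>)
    finally show ?case .
  qed
  have "A ^\<^sub>m Suc m = 0\<^sub>m n n" "A ^\<^sub>m m * E = 0\<^sub>m n 1" using A E by (auto simp: m)
  then have "(block_reduced n k A) ^\<^sub>m Suc m = four_block_mat (0\<^sub>m n n) (0\<^sub>m n 1) (0\<^sub>m 1 n) (0\<^sub>m 1 1)"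
    using pow[of m] by (simp only:)
  also have "\<dots> = 0\<^sub>m (n + 1) (n + 1)" by (rule eq_matI) auto
  finally have zero: "(block_reduced n k A) ^\<^sub>m Suc m = 0\<^sub>m (n + 1) (n + 1)" .
  obtain P Q where PQ: "similar_mat_wit (bordered_mat n k A) (block_reduced n k A) P Q"
    using bordered_mat_similar[OF A k] by blast
  have "P \<in> carrier_mat (n + 1) (n + 1)" "Q \<in> carrier_mat (n + 1) (n + 1)"
    using similar_mat_witD2[OF bordered_mat_carrier[OF A] PQ] by auto
  then have "(bordered_mat n k A) ^\<^sub>m Suc m = 0\<^sub>m (n + 1) (n + 1)"
    unfolding similar_mat_wit_pow_id[OF PQ] zero by simp
  then show ?thesis unfolding nilpotent_mat_def
    using bordered_mat_carrier[OF A, of k] by (auto simp del: pow_mat.simps)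
qed

section \<open>The Jacobian of the bordered matrix\<close>

text \<open>Increase the entry (i, j) of A by 1 in the identity for the characteristic polynomial
  of the bordered matrix. Away from row k, the bordered matrix changes in that entry only.\<close>
lemma entry_deriv_bordered_off_row:
  assumes A: "A \<in> carrier_mat n n" and k: "k < n" and ij: "i < n" "j < n" "i \<noteq> k"
  shows "[:0, 1:] * entry_deriv A i j = entry_deriv (bordered_mat n k A) i j"
proof -
  define A' where "A' = mat n n (\<lambda>p. A $$ p + (if p = (i, j) then 1 else 0))"
  have A': "A' \<in> carrier_mat n n" by (simp add: A'_def)
  have ent: "A' $$ (p, l) = A $$ (p, l) + (if (p, l) = (i, j) then 1 else 0)" if "p < n" "l < n" for p l
    using that by (simp add: A'_def)
  note idx = bordered_mat_index[OF A k] bordered_mat_index[OF A' k]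
  have 1: "char_poly A' = char_poly A + entry_deriv A i j"
    using char_poly_change_entry[OF A A' ij(1,2)] ij by (simp add: A'_def)
  have "char_poly (bordered_mat n k A') = char_poly (bordered_mat n k A) +
      Polynomial.smult (bordered_mat n k A' $$ (i, j) - bordered_mat n k A $$ (i, j))
        (entry_deriv (bordered_mat n k A) i j)"
  proof (rule char_poly_change_entry[OF bordered_mat_carrier[OF A] bordered_mat_carrier[OF A']])
    fix p l assume pl: "p < n + 1" "l < n + 1" "(p, l) \<noteq> (i, j)"
    then have "p < n \<or> p = n" "l < n \<or> l = n" by auto
    then show "bordered_mat n k A' $$ (p, l) = bordered_mat n k A $$ (p, l)"
      using pl ij k by (elim disjE) (simp_all add: idx ent)
  qed (use ij in auto)
  moreover have "bordered_mat n k A' $$ (i, j) - bordered_mat n k A $$ (i, j) = 1"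
    using ij by (simp add: idx ent)
  ultimately show ?thesis
    unfolding char_poly_bordered_mat[OF A k] char_poly_bordered_mat[OF A' k] 1
    by (simp only: distrib_left add_left_cancel smult_1_left)
qed

text \<open>Row k of A enters the bordered matrix twice: increasing the entry (k, j) by 1 changes the
  entry (k, j) by 1 and the entry (n, j) by the diagonal entry of row k. Both lie in column j, so the expansion is exact.\<close>
lemma entry_deriv_bordered_row:
  assumes A: "A \<in> carrier_mat n n" and k: "k < n" and j: "j < n" "j \<noteq> k"
  shows "[:0, 1:] * entry_deriv A k j = entry_deriv (bordered_mat n k A) k j
    + Polynomial.smult (A $$ (k, k)) (entry_deriv (bordered_mat n k A) n j)"
proof -
  define A' where "A' = mat n n (\<lambda>p. A $$ p + (if p = (k, j) then 1 else 0))"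
  have A': "A' \<in> carrier_mat n n" by (simp add: A'_def)
  have ent: "A' $$ (p, l) = A $$ (p, l) + (if (p, l) = (k, j) then 1 else 0)" if "p < n" "l < n" for p l
    using that by (simp add: A'_def)
  note idx = bordered_mat_index[OF A k] bordered_mat_index[OF A' k]
  let ?B = "bordered_mat n k A" and ?B' = "bordered_mat n k A'"
  have 1: "char_poly A' = char_poly A + entry_deriv A k j"
    using char_poly_change_entry[OF A A' k j(1)] k j by (simp add: A'_def)
  have "char_poly ?B' = char_poly ?B +
      (\<Sum>p<n + 1. Polynomial.smult (?B' $$ (p, j) - ?B $$ (p, j)) (entry_deriv ?B p j))"
  proof (rule char_poly_change_column[OF bordered_mat_carrier[OF A] bordered_mat_carrier[OF A']])
    fix p l assume pl: "p < n + 1" "l < n + 1" "l \<noteq> j"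
    then have "p < n \<or> p = n" "l < n \<or> l = n" by auto
    then show "?B' $$ (p, l) = ?B $$ (p, l)"
      using pl j k by (elim disjE) (simp_all add: idx ent)
  qed (use j in auto)
  also have "(\<Sum>p<n + 1. Polynomial.smult (?B' $$ (p, j) - ?B $$ (p, j)) (entry_deriv ?B p j)) =
      (\<Sum>p<n. if p = k then entry_deriv ?B k j else 0) + Polynomial.smult (A $$ (k, k)) (entry_deriv ?B n j)"
  proof -
    have "?B' $$ (p, j) - ?B $$ (p, j) = (if p = k then 1 else 0)" if "p < n" for p
      using that j k by (simp add: idx ent)
    moreover have "?B' $$ (n, j) - ?B $$ (n, j) = A $$ (k, k)"
      using j k by (simp add: idx ent algebra_simps)
    ultimately have "(\<Sum>p<n + 1. Polynomial.smult (?B' $$ (p, j) - ?B $$ (p, j)) (entry_deriv ?B p j)) =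
      (\<Sum>p<n. Polynomial.smult (if p = k then 1 else 0) (entry_deriv ?B p j))
        + Polynomial.smult (A $$ (k, k)) (entry_deriv ?B n j)" by simp
    also have "(\<Sum>p<n. Polynomial.smult (if p = k then 1 else 0) (entry_deriv ?B p j)) =
        (\<Sum>p<n. if p = k then entry_deriv ?B k j else 0)" by (rule sum.cong) auto
    finally show ?thesis .
  qed
  finally have "[:0, 1:] * entry_deriv A k j = (\<Sum>p<n. if p = k then entry_deriv ?B k j else 0)
      + Polynomial.smult (A $$ (k, k)) (entry_deriv ?B n j)"
    unfolding char_poly_bordered_mat[OF A k] char_poly_bordered_mat[OF A' k] 1
    by (simp only: distrib_left add_left_cancel)
  then show ?thesis using k by (simp only: sum.delta finite_lessThan lessThan_iff if_True)
qed

text \<open>The entry (k, k) of A occurs in the bordered matrix only as a factor of the last row, so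
  the change stays within that row.\<close>
lemma entry_deriv_bordered_pivot:
  assumes A: "A \<in> carrier_mat n n" and k: "k < n"
  shows "[:0, 1:] * entry_deriv A k k = entry_deriv (bordered_mat n k A) n n
    + (\<Sum>l<n. Polynomial.smult (if l = k then 0 else A $$ (k, l)) (entry_deriv (bordered_mat n k A) n l))"
proof -
  define A' where "A' = mat n n (\<lambda>p. A $$ p + (if p = (k, k) then 1 else 0))"
  have A': "A' \<in> carrier_mat n n" by (simp add: A'_def)
  have ent: "A' $$ (p, l) = A $$ (p, l) + (if (p, l) = (k, k) then 1 else 0)" if "p < n" "l < n" for p l
    using that by (simp add: A'_def)
  note idx = bordered_mat_index[OF A k] bordered_mat_index[OF A' k]
  let ?B = "bordered_mat n k A" and ?B' = "bordered_mat n k A'"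
  have 1: "char_poly A' = char_poly A + entry_deriv A k k"
    using char_poly_change_entry[OF A A' k k] k by (simp add: A'_def)
  have "char_poly ?B' = char_poly ?B +
      (\<Sum>l<n + 1. Polynomial.smult (?B' $$ (n, l) - ?B $$ (n, l)) (entry_deriv ?B n l))"
  proof (rule char_poly_change_row[OF bordered_mat_carrier[OF A] bordered_mat_carrier[OF A']])
    fix p l assume pl: "p < n + 1" "l < n + 1" "p \<noteq> n"
    then have "p < n" "l < n \<or> l = n" by auto
    then show "?B' $$ (p, l) = ?B $$ (p, l)"
      using pl k by (elim disjE) (simp_all add: idx ent)
  qed simp
  also have "(\<Sum>l<n + 1. Polynomial.smult (?B' $$ (n, l) - ?B $$ (n, l)) (entry_deriv ?B n l)) =
      (\<Sum>l<n. Polynomial.smult (if l = k then 0 else A $$ (k, l)) (entry_deriv ?B n l)) + entry_deriv ?B n n"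
  proof -
    have "?B' $$ (n, l) - ?B $$ (n, l) = (if l = k then 0 else A $$ (k, l))" if "l < n" for l
      using that k by (simp add: idx ent algebra_simps)
    moreover have "?B' $$ (n, n) - ?B $$ (n, n) = 1"
      using k by (simp add: idx ent)
    ultimately show ?thesis by simp
  qed
  finally have "[:0, 1:] * entry_deriv A k k =
      (\<Sum>l<n. Polynomial.smult (if l = k then 0 else A $$ (k, l)) (entry_deriv ?B n l)) + entry_deriv ?B n n"
    unfolding char_poly_bordered_mat[OF A k] char_poly_bordered_mat[OF A' k] 1
    by (simp only: distrib_left add_left_cancel)
  then show ?thesis by (simp only: add.commute)
qed

text \<open>The differentiated identities express z times the derivative of A at a nonzero position
  through derivatives of the bordered matrix. The positions that occur with a
  nonzero coefficient carry nonzero entries there, because row k of A, outside its diagonal entry,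
  is repeated in the last row with the nonzero factor from the position (k, k).\<close>
lemma reachable_bordered:
  assumes A: "A \<in> carrier_mat n n" and k: "k < n" and a: "A $$ (k, k) \<noteq> 0" and q: "reachable A q"
  shows "reachable (bordered_mat n k A) ([:0, 1:] * q)"
proof -
  let ?B = "bordered_mat n k A"
  have dim: "dim_row ?B = n + 1" using bordered_mat_carrier[OF A] by blast
  note idx = bordered_mat_index[OF A k]
  have entry: "reachable ?B ([:0, 1:] * entry_deriv A i j)" if "i < n" "j < n" "A $$ (i, j) \<noteq> 0" for i j
  proof -
    consider "i \<noteq> k" | "i = k" "j \<noteq> k" | "i = k" "j = k" by blast
    then show ?thesis
    proof cases
      case 1
      then show ?thesis unfolding entry_deriv_bordered_off_row[OF A k that(1,2) 1]
        using that by (intro reachable_entry_deriv) (auto simp: dim idx)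
    next
      case 2
      then show ?thesis unfolding 2(1) entry_deriv_bordered_row[OF A k that(2) 2(2)]
        using that 2 a k by (intro reachable_add reachable_smult reachable_entry_deriv) (auto simp: dim idx)
    next
      case 3
      have "reachable ?B (Polynomial.smult (if l = k then 0 else A $$ (k, l)) (entry_deriv ?B n l))" if "l < n" for l
      proof (cases "l = k \<or> A $$ (k, l) = 0")
        case True
        then show ?thesis by (auto simp: reachable_0)
      next
        case False
        then show ?thesis using that a by (intro reachable_smult reachable_entry_deriv) (auto simp: dim idx)
      qed
      then show ?thesis unfolding 3 entry_deriv_bordered_pivot[OF A k]
        using a by (intro reachable_add reachable_sum reachable_entry_deriv) (auto simp: dim idx)
    qed
  qed
  obtain D where D: "\<forall>p. A $$ p = 0 \<longrightarrow> D p = 0"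
    "q = (\<Sum>(i, j)\<in>{..<n} \<times> {..<n}. Polynomial.smult (D (i, j)) (entry_deriv A i j))"
    using q carrier_matD(1)[OF A] unfolding reachable_def by auto
  have "[:0, 1:] * q = (\<Sum>p\<in>{..<n} \<times> {..<n}. Polynomial.smult (D p) ([:0, 1:] * entry_deriv A (fst p) (snd p)))"
    unfolding D(2) sum_distrib_left by (rule sum.cong) (auto simp: mult_smult_right)
  also have "reachable ?B \<dots>"
  proof (rule reachable_sum)
    fix p assume p: "p \<in> {..<n} \<times> {..<n}"
    show "reachable ?B (Polynomial.smult (D p) ([:0, 1:] * entry_deriv A (fst p) (snd p)))"
    proof (cases "A $$ p = 0")
      case True
      then have "D p = 0" using D(1) by blast
      then show ?thesis by (simp only: smult_0_left reachable_0)
    next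
      case False
      then show ?thesis using p by (intro reachable_smult entry) auto
    qed
  qed
  finally show ?thesis .
qed

text \<open>At z = 0 this is, up to sign, the minor of the bordered matrix without row n and column
  v. Its last column is the k-th unit vector, and expanding along it leaves the given minor of A.\<close>
lemma coeff_0_entry_deriv_bordered:
  assumes A: "A \<in> carrier_mat n n" and k: "k < n" and v: "v < n"
    and det: "Determinant.det (mat_delete A k v) \<noteq> 0"
  shows "coeff (entry_deriv (bordered_mat n k A) n v) 0 \<noteq> 0"
proof -
  let ?B = "bordered_mat n k A"
  have B: "?B \<in> carrier_mat (n + 1) (n + 1)" by (rule bordered_mat_carrier[OF A])
  note idx = bordered_mat_index[OF A k]
  define Y where "Y = mat_delete (- ?B) n v"
  have Y: "Y \<in> carrier_mat n n" using mat_delete_carrier[of "- ?B" "n + 1" "n + 1" n v] B by (simp add: Y_def)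
  have X: "mat_delete (char_poly_matrix ?B) n v \<in> carrier_mat n n"
    using mat_delete_carrier[of "char_poly_matrix ?B" "n + 1" "n + 1" n v] B by simp
  have "poly (Determinant.det (mat_delete (char_poly_matrix ?B) n v)) 0 = Determinant.det Y"
  proof (rule poly_det_cong[OF Y X])
    fix i j assume ij: "i < n" "j < n"
    then show "poly (mat_delete (char_poly_matrix ?B) n v $$ (i, j)) 0 = Y $$ (i, j)"
      using B by (auto simp: Y_def mat_delete_def char_poly_matrix_def)
  qed
  then have 1: "coeff (entry_deriv ?B n v) 0 = - ((-1) ^ (n + v) * Determinant.det Y)"
    by (simp add: entry_deriv_def cofactor_def poly_0_coeff_0[symmetric])
  have Ylast: "Y $$ (i, n - 1) = (if i = k then -1 else 0)" if "i < n" for i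
    using that v B k by (auto simp: Y_def mat_delete_def idx)
  have "Determinant.det Y = (\<Sum>i<n. Y $$ (i, n - 1) * cofactor Y i (n - 1))"
    using k by (intro laplace_expansion_column[OF Y]) simp
  also have "\<dots> = (\<Sum>i<n. if i = k then - cofactor Y k (n - 1) else 0)"
    by (rule sum.cong) (simp_all add: Ylast del: One_nat_def)
  also have "\<dots> = - cofactor Y k (n - 1)" using k by simp
  also have "\<dots> = - ((-1) ^ (k + (n - 1)) * Determinant.det (- mat_delete A k v))"
  proof -
    have "mat_delete Y k (n - 1) = - mat_delete A k v"
    proof (rule eq_matI)
      fix i j assume "i < dim_row (- mat_delete A k v)" "j < dim_col (- mat_delete A k v)"
      then have ij: "i < n - 1" "j < n - 1" using A by auto
      then show "mat_delete Y k (n - 1) $$ (i, j) = (- mat_delete A k v) $$ (i, j)"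
        using A B Y k v by (auto simp: Y_def mat_delete_def idx)
    qed (use A Y in auto)
    then show ?thesis by (simp add: cofactor_def)
  qed
  finally have 2: "Determinant.det Y = - ((-1) ^ (k + (n - 1)) * Determinant.det (- mat_delete A k v))" .
  have "Determinant.det (- mat_delete A k v) \<noteq> 0"
    using det det_0_negate[OF mat_delete_carrier[OF A, of k v]] by simp
  then show ?thesis unfolding 1 2 by simp
qed

text \<open>The directions inherited from A give all multiples of z of degree at most n. The position
  (n, v), at which the bordered matrix has the product of the entries (k, k) and (k, v) of A as its
  nonzero entry, supplies the missing constant term.\<close>
lemma full_rank_jacobian_bordered:
  assumes A: "A \<in> carrier_mat n n" and k: "k < n" and v: "v < n" "v \<noteq> k"
    and jac: "allows_full_rank_jacobian A"
    and a: "A $$ (k, k) \<noteq> 0" and akv: "A $$ (k, v) \<noteq> 0"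
    and det: "Determinant.det (mat_delete A k v) \<noteq> 0"
  shows "allows_full_rank_jacobian (bordered_mat n k A)"
proof -
  let ?B = "bordered_mat n k A"
  have B: "?B \<in> carrier_mat (n + 1) (n + 1)" by (rule bordered_mat_carrier[OF A])
  have reachA: "reachable A q" if "degree q < n" for q
  proof -
    have "n > 0" using k by simp
    then show ?thesis using jac that allows_full_rank_jacobian_iff[OF A] by blast
  qed
  define g where "g = entry_deriv ?B n v"
  have g0: "coeff g 0 \<noteq> 0" unfolding g_def by (rule coeff_0_entry_deriv_bordered[OF A k v(1) det])
  have reach_g: "reachable ?B g"
    unfolding g_def using B v a akv bordered_mat_index(3)[OF A k v(1)] by (intro reachable_entry_deriv) auto
  have "reachable ?B q" if q: "degree q < n + 1" for q
  proof -
    define c where "c = coeff q 0 / coeff g 0"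
    define h where "h = q - Polynomial.smult c g"
    have "coeff h 0 = 0" using g0 by (simp add: h_def c_def)
    then obtain h' where h': "h = [:0, 1:] * h'"
      by (cases h) auto
    have "coeff h' r = 0" if "r \<ge> n" for r
    proof -
      have "coeff h' r = coeff h (Suc r)" by (simp add: h')
      also have "\<dots> = 0" using that q coeff_entry_deriv_eq_0[OF B, of n v "Suc r"] v
        by (simp add: h_def g_def coeff_eq_0)
      finally show ?thesis .
    qed
    then have "degree h' < n" using k by (intro degree_lessI) auto
    then have "reachable ?B h" unfolding h' by (intro reachable_bordered[OF A k a] reachA)
    then have "reachable ?B (h + Polynomial.smult c g)" using reach_g by (intro reachable_add reachable_smult)
    then show ?thesis by (simp add: h_def)
  qed
  then show ?thesis using allows_full_rank_jacobian_iff[OF B] by simp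
qed

section \<open>Local solvability of underdetermined equations\<close>

definition C1_fun :: "('a::real_normed_vector \<Rightarrow> real) \<Rightarrow> bool" where
  "C1_fun f \<longleftrightarrow> (\<exists>f' :: 'a \<Rightarrow> 'a \<Rightarrow>\<^sub>L real.
     (\<forall>x. (f has_derivative blinfun_apply (f' x)) (at x)) \<and> continuous_on UNIV (\<lambda>x. f' x))"

lemma C1_fun_const: "C1_fun (\<lambda>_. c)"
  unfolding C1_fun_def
  by (rule exI[of _ "\<lambda>_. 0"]) (auto intro!: derivative_eq_intros continuous_intros)

lemma C1_fun_bounded_linear:
  assumes "bounded_linear f"
  shows "C1_fun f"
  unfolding C1_fun_def
  by (rule exI[of _ "\<lambda>_. Blinfun f"])
     (auto simp: bounded_linear_Blinfun_apply[OF assms] intro: assms bounded_linear_imp_has_derivative)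

lemma C1_fun_add:
  assumes "C1_fun f" "C1_fun g"
  shows "C1_fun (\<lambda>x. f x + g x)"
proof -
  obtain f' g' where *: "\<And>x. (f has_derivative blinfun_apply (f' x)) (at x)" "continuous_on UNIV f'"
    "\<And>x. (g has_derivative blinfun_apply (g' x)) (at x)" "continuous_on UNIV g'"
    using assms unfolding C1_fun_def by auto
  show ?thesis unfolding C1_fun_def
    by (rule exI[of _ "\<lambda>x. f' x + g' x"])
       (auto intro!: derivative_eq_intros continuous_intros * simp: blinfun.bilinear_simps)
qed

lemma C1_fun_mult:
  assumes "C1_fun f" "C1_fun g"
  shows "C1_fun (\<lambda>x. f x * g x)"
proof -
  obtain f' g' where *: "\<And>x. (f has_derivative blinfun_apply (f' x)) (at x)" "continuous_on UNIV f'"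
    "\<And>x. (g has_derivative blinfun_apply (g' x)) (at x)" "continuous_on UNIV g'"
    using assms unfolding C1_fun_def by auto
  have cont: "continuous_on UNIV f" "continuous_on UNIV g"
    using *(1,3) by (auto intro!: continuous_at_imp_continuous_on has_derivative_continuous)
  show ?thesis unfolding C1_fun_def
    by (rule exI[of _ "\<lambda>x. f x *\<^sub>R g' x + g x *\<^sub>R f' x"])
       (auto intro!: derivative_eq_intros continuous_intros * cont simp: blinfun.bilinear_simps)
qed

lemma C1_fun_sum:
  assumes "\<And>i. i \<in> I \<Longrightarrow> C1_fun (f i)"
  shows "C1_fun (\<lambda>x. \<Sum>i\<in>I. f i x)"
  using assms by (induction I rule: infinite_finite_induct) (auto intro: C1_fun_const C1_fun_add)

text \<open>Continuity of the derivative makes f minus its linear part a function with arbitrarily small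
  Lipschitz constant near x0; this is the estimate that drives the Newton iteration.\<close>
lemma C1_deriv_linearization:
  fixes f :: "'a::real_normed_vector \<Rightarrow> real" and f' :: "'a \<Rightarrow> 'a \<Rightarrow>\<^sub>L real"
  assumes der: "\<And>x. (f has_derivative f' x) (at x)" and cont: "continuous_on UNIV f'" and "e > 0"
  shows "\<exists>\<rho>>0. \<forall>x\<in>cball x0 \<rho>. \<forall>y\<in>cball x0 \<rho>. \<bar>f x - f y - f' x0 (x - y)\<bar> \<le> e * norm (x - y)"
proof -
  have "isCont f' x0" using cont by (simp add: continuous_on_eq_continuous_at)
  then obtain d where d: "d > 0" "\<And>x. dist x x0 < d \<Longrightarrow> dist (f' x) (f' x0) < e"
    using \<open>e > 0\<close> unfolding continuous_at_eps_delta by blast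
  have "\<bar>f x - f y - f' x0 (x - y)\<bar> \<le> e * norm (x - y)"
    if "x \<in> cball x0 (d/2)" "y \<in> cball x0 (d/2)" for x y
  proof -
    have "norm (f x - f y - f' x0 (x - y)) \<le> norm (x - y) * e"
    proof (rule differentiable_bound_linearization[where S = "cball x0 (d/2)"])
      show "y + t *\<^sub>R (x - y) \<in> cball x0 (d/2)" if "t \<in> {0..1}" for t
        using that \<open>x \<in> _\<close> \<open>y \<in> _\<close> convexD_alt[OF convex_cball, of y x0 "d/2" x t]
        by (auto simp: algebra_simps)
      show "(f has_derivative blinfun_apply (f' z)) (at z within cball x0 (d/2))" for z
        using der has_derivative_at_withinI by blast
      show "onorm (blinfun_apply (f' z) - blinfun_apply (f' x0)) \<le> e" if "z \<in> cball x0 (d/2)" for z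
      proof -
        have "dist (f' z) (f' x0) < e" using that d by (intro d(2)) (auto simp: dist_commute)
        moreover have "blinfun_apply (f' z) - blinfun_apply (f' x0) = blinfun_apply (f' z - f' x0)"
          by (auto simp: blinfun.bilinear_simps)
        ultimately show ?thesis by (simp add: dist_norm norm_blinfun.rep_eq)
      qed
    qed (use d in auto)
    then show ?thesis by (simp add: mult.commute)
  qed
  then show ?thesis using d(1) by (intro exI[of _ "d/2"]) auto
qed

text \<open>The vectors d r form a right inverse of the differential at x0, and the equations F r = y r are
  solved by the simplified Newton iteration with this right inverse. Along
  span d the differential of the iteration map at x0 vanishes, so that the map is a contraction on
  the part of x1 + span d near x0. The base point x1 may be moved independently: this leaves
  directions transversal to span d at one's disposal.\<close>
lemma local_solvability:
  fixes F :: "nat \<Rightarrow> 'a::{real_normed_vector, complete_space} \<Rightarrow> real" and F' :: "nat \<Rightarrow> 'a \<Rightarrow> 'a \<Rightarrow>\<^sub>L real" and d :: "nat \<Rightarrow> 'a"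
  assumes der: "\<And>r x. r < N \<Longrightarrow> (F r has_derivative F' r x) (at x)"
    and cont: "\<And>r. r < N \<Longrightarrow> continuous_on UNIV (F' r)"
    and dual: "\<And>r s. r < N \<Longrightarrow> s < N \<Longrightarrow> F' r x0 (d s) = (if r = s then 1 else 0)"
    and "\<epsilon> > 0"
  shows "\<exists>\<delta>>0. \<forall>x1 y. dist x1 x0 < \<delta> \<and> (\<forall>r<N. \<bar>y r - F r x0\<bar> < \<delta>) \<longrightarrow>
    (\<exists>c. dist (x1 + (\<Sum>r<N. c r *\<^sub>R d r)) x0 < \<epsilon> \<and> (\<forall>r<N. F r (x1 + (\<Sum>r<N. c r *\<^sub>R d r)) = y r))"
proof -
  define D where "D = (\<Sum>r<N. norm (d r))"
  have D0: "D \<ge> 0" unfolding D_def by (simp add: sum_nonneg)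
  \<comment> \<open>This accuracy of the linearization gives the iteration the contraction factor 1/2.\<close>
  define e where "e = 1 / (2 * (D + 1))"
  have e: "e > 0" "e * D \<le> 1/2" using D0 by (auto simp: e_def field_simps)
  have "\<exists>\<rho>. \<forall>r<N. \<rho> r > 0 \<and> (\<forall>x\<in>cball x0 (\<rho> r). \<forall>y\<in>cball x0 (\<rho> r).
      \<bar>F r x - F r y - F' r x0 (x - y)\<bar> \<le> e * norm (x - y))"
    using C1_deriv_linearization[OF der cont \<open>e > 0\<close>, of _ x0] by metis
  then obtain \<rho>' where \<rho>': "\<And>r. r < N \<Longrightarrow> \<rho>' r > 0"
    "\<And>r x y. r < N \<Longrightarrow> x \<in> cball x0 (\<rho>' r) \<Longrightarrow> y \<in> cball x0 (\<rho>' r) \<Longrightarrow>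
      \<bar>F r x - F r y - F' r x0 (x - y)\<bar> \<le> e * norm (x - y)" by blast
  define \<rho> where "\<rho> = Min (insert (\<epsilon>/2) (\<rho>' ` {..<N}))"
  have \<rho>: "\<rho> > 0" "\<rho> < \<epsilon>"
  proof -
    show "\<rho> > 0" unfolding \<rho>_def using \<rho>'(1) \<open>\<epsilon> > 0\<close> by (subst Min_gr_iff) auto
    have "\<rho> \<le> \<epsilon>/2" unfolding \<rho>_def by (rule Min_le) auto
    then show "\<rho> < \<epsilon>" using \<open>\<epsilon> > 0\<close> by auto
  qed
  have "\<rho> \<le> \<rho>' r" if "r < N" for r unfolding \<rho>_def using that by (intro Min_le) auto
  then have lin: "\<bar>F r x - F r y - F' r x0 (x - y)\<bar> \<le> e * norm (x - y)"
    if "r < N" "x \<in> cball x0 \<rho>" "y \<in> cball x0 \<rho>" for r x y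
    using \<rho>'(2)[of r x y] that by force
  define K where "K = (\<Sum>r<N. norm (F' r x0))"
  have K: "norm (F' r x0) \<le> K" if "r < N" for r
    unfolding K_def using that by (intro member_le_sum) auto
  have K0: "K \<ge> 0" unfolding K_def by (simp add: sum_nonneg)
  \<comment> \<open>The first step and the displacement of x1 from x0 together are then at most a quarter of the radius,
    so that the iteration stays in the ball.\<close>
  define \<delta> where "\<delta> = \<rho> / (4 * (1 + D * (1 + e + K)))"
  have den: "1 + D * (1 + e + K) \<ge> 1" using D0 K0 e by simp
  have \<delta>: "\<delta> > 0" "\<delta> * (1 + D * (1 + e + K)) = \<rho>/4"
    using \<rho> den by (auto simp: \<delta>_def field_simps)
  have \<delta>\<rho>: "\<delta> \<le> \<rho>/4"
    using mult_left_mono[OF den, of \<delta>] \<delta> by simp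
  show ?thesis
  proof (intro exI[of _ \<delta>] conjI allI impI, rule \<open>\<delta> > 0\<close>, elim conjE)
    fix x1 y assume x1: "dist x1 x0 < \<delta>" and y: "\<forall>r<N. \<bar>y r - F r x0\<bar> < \<delta>"
    \<comment> \<open>The condition on x - x1 describes x1 + span d by a closed equation, as the coefficients of a
      vector in span d are its images under the differentials at x0.\<close>
    define S where "S = {x \<in> cball x0 \<rho>. x - x1 = (\<Sum>r<N. F' r x0 (x - x1) *\<^sub>R d r)}"
    define \<Phi> where "\<Phi> x = x - (\<Sum>r<N. (F r x - y r) *\<^sub>R d r)" for x
    have comb: "F' r x0 (\<Sum>s<N. c s *\<^sub>R d s) = c r" if "r < N" for r c
    proof -
      have "F' r x0 (\<Sum>s<N. c s *\<^sub>R d s) = (\<Sum>s<N. if s = r then c s else 0)"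
        unfolding blinfun.sum_right blinfun.scaleR_right
        by (rule sum.cong) (auto simp: dual that)
      also have "\<dots> = c r" using that by simp
      finally show ?thesis .
    qed
    have diff: "x - z = (\<Sum>r<N. F' r x0 (x - z) *\<^sub>R d r)" if "x \<in> S" "z \<in> S" for x z
    proof -
      have "x - z = (x - x1) - (z - x1)" by simp
      also have "\<dots> = (\<Sum>r<N. F' r x0 (x - x1) *\<^sub>R d r) - (\<Sum>r<N. F' r x0 (z - x1) *\<^sub>R d r)"
        using that unfolding S_def by auto
      also have "\<dots> = (\<Sum>r<N. F' r x0 (x - z) *\<^sub>R d r)"
        unfolding sum_subtractf[symmetric] scaleR_diff_left[symmetric] blinfun.diff_right[symmetric] by simp
      finally show ?thesis .
    qed
    have contr: "norm (\<Phi> x - \<Phi> z) \<le> 1/2 * norm (x - z)" if "x \<in> S" "z \<in> S" for x z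
    proof -
      have "\<Phi> x - \<Phi> z = (\<Sum>r<N. F' r x0 (x - z) *\<^sub>R d r) - (\<Sum>r<N. (F r x - y r) *\<^sub>R d r)
          + (\<Sum>r<N. (F r z - y r) *\<^sub>R d r)"
        unfolding \<Phi>_def using diff[OF that] by (simp add: algebra_simps)
      also have "\<dots> = (\<Sum>r<N. (- (F r x - F r z - F' r x0 (x - z))) *\<^sub>R d r)"
        unfolding sum_subtractf[symmetric] sum.distrib[symmetric]
        by (rule sum.cong) (auto simp: algebra_simps)
      also have "norm \<dots> \<le> (\<Sum>r<N. (e * norm (x - z)) * norm (d r))"
      proof (rule sum_norm_le)
        fix r assume "r \<in> {..<N}"
        then have "\<bar>F r x - F r z - F' r x0 (x - z)\<bar> \<le> e * norm (x - z)"
          using that by (intro lin) (auto simp: S_def)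
        then show "norm ((- (F r x - F r z - F' r x0 (x - z))) *\<^sub>R d r) \<le> e * norm (x - z) * norm (d r)"
          by (simp only: norm_scaleR abs_minus_cancel) (rule mult_right_mono, auto)
      qed
      also have "\<dots> = (e * D) * norm (x - z)"
        unfolding D_def sum_distrib_left[symmetric] by simp
      also have "\<dots> \<le> 1/2 * norm (x - z)" by (rule mult_right_mono[OF e(2)]) simp
      finally show ?thesis .
    qed
    have x1S: "x1 \<in> S" unfolding S_def using x1 \<delta>\<rho> \<delta>(1) by (auto simp: dist_commute)
    have close: "norm (\<Phi> x1 - x1) \<le> \<delta> * (D * (1 + e + K))"
    proof -
      have "norm (\<Phi> x1 - x1) = norm (\<Sum>r<N. (y r - F r x1) *\<^sub>R d r)"
        unfolding \<Phi>_def by (simp add: sum_negf[symmetric] scaleR_minus_left[symmetric] del: sum_negf scaleR_minus_left)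
      also have "\<dots> \<le> (\<Sum>r<N. (\<delta> * (1 + e + K)) * norm (d r))"
      proof (rule sum_norm_le)
        fix r assume "r \<in> {..<N}"
        then have r: "r < N" by simp
        have "\<bar>F r x1 - F r x0 - F' r x0 (x1 - x0)\<bar> \<le> e * norm (x1 - x0)"
          using r x1S \<rho>(1) by (intro lin) (auto simp: S_def)
        also have "\<dots> \<le> e * \<delta>" using e x1 by (intro mult_left_mono) (auto simp: dist_norm)
        finally have 1: "\<bar>F r x1 - F r x0 - F' r x0 (x1 - x0)\<bar> \<le> e * \<delta>" .
        have "\<bar>F' r x0 (x1 - x0)\<bar> \<le> norm (F' r x0) * norm (x1 - x0)"
          using norm_blinfun[of "F' r x0" "x1 - x0"] by simp
        also have "\<dots> \<le> K * \<delta>" using K[OF r] x1 K0 by (intro mult_mono) (auto simp: dist_norm)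
        finally have "\<bar>F' r x0 (x1 - x0)\<bar> \<le> K * \<delta>" .
        with 1 y r have "\<bar>y r - F r x1\<bar> \<le> \<delta> + e * \<delta> + K * \<delta>" by (smt (verit))
        then have "\<bar>y r - F r x1\<bar> \<le> \<delta> * (1 + e + K)" by (simp add: algebra_simps)
        then show "norm ((y r - F r x1) *\<^sub>R d r) \<le> \<delta> * (1 + e + K) * norm (d r)"
          by (simp only: norm_scaleR) (rule mult_right_mono, auto)
      qed
      also have "\<dots> = \<delta> * (D * (1 + e + K))"
        unfolding D_def sum_distrib_left[symmetric] by simp
      finally show ?thesis .
    qed
    have "\<exists>!x\<in>S. \<Phi> x = x"
    proof (rule Banach_fix[where c = "1/2"])
      have "closed S"
      proof -
        have "S = cball x0 \<rho> \<inter> {x. x - x1 = (\<Sum>r<N. F' r x0 (x - x1) *\<^sub>R d r)}"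
          unfolding S_def by auto
        then show ?thesis by (auto intro!: closed_Int closed_Collect_eq continuous_intros)
      qed
      then show "complete S" by (simp add: complete_eq_closed)
      show "S \<noteq> {}" using x1S by auto
      show "\<Phi> ` S \<subseteq> S"
      proof
        fix u assume "u \<in> \<Phi> ` S"
        then obtain x where x: "x \<in> S" "u = \<Phi> x" by auto
        have "u - x1 = (x - x1) - (\<Sum>r<N. (F r x - y r) *\<^sub>R d r)"
          unfolding x \<Phi>_def by simp
        also have "\<dots> = (\<Sum>r<N. (F' r x0 (x - x1) - (F r x - y r)) *\<^sub>R d r)"
          using x(1) unfolding S_def by (simp add: sum_subtractf scaleR_diff_left[of "blinfun_apply _ _"])
        finally have eq: "u - x1 = (\<Sum>r<N. (F' r x0 (x - x1) - (F r x - y r)) *\<^sub>R d r)" .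
        have span: "u - x1 = (\<Sum>r<N. F' r x0 (u - x1) *\<^sub>R d r)"
          by (subst (1) eq, subst eq, rule sum.cong) (auto simp: comb)
        have "norm (x - x1) \<le> \<rho> + \<delta>"
        proof -
          have "norm (x - x1) \<le> norm (x - x0) + norm (x1 - x0)"
            using norm_triangle_ineq4[of "x - x0" "x1 - x0"] by simp
          then show ?thesis using x(1) x1 by (auto simp: S_def dist_norm norm_minus_commute)
        qed
        then have "norm (\<Phi> x - \<Phi> x1) \<le> 1/2 * (\<rho> + \<delta>)" using contr[OF x(1) x1S] by simp
        moreover have "norm (u - x0) \<le> norm (\<Phi> x - \<Phi> x1) + norm (\<Phi> x1 - x1) + norm (x1 - x0)"
          unfolding x by (smt (verit) diff_add_cancel add_diff_eq norm_triangle_ineq)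
        ultimately have "norm (u - x0) \<le> 1/2 * (\<rho> + \<delta>) + \<delta> * (D * (1 + e + K)) + \<delta>"
          using close x1 unfolding dist_norm by linarith
        also have "\<dots> = 1/2 * (\<rho> + \<delta>) + \<rho>/4" using \<delta>(2) by (simp add: algebra_simps)
        also have "\<dots> \<le> \<rho>" using \<delta>\<rho> \<rho>(1) by (simp add: field_simps)
        finally show "u \<in> S" using span by (auto simp: S_def dist_norm norm_minus_commute)
      qed
      show "dist (\<Phi> x) (\<Phi> z) \<le> 1/2 * dist x z" if "x \<in> S" "z \<in> S" for x z
        using contr[OF that] by (simp add: dist_norm)
    qed auto
    then obtain x where x: "x \<in> S" "\<Phi> x = x" by auto
    define c where "c r = F' r x0 (x - x1)" for r
    have xc: "x1 + (\<Sum>r<N. c r *\<^sub>R d r) = x" using x(1) unfolding S_def c_def by (simp add: algebra_simps)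
    have "(\<Sum>r<N. (F r x - y r) *\<^sub>R d r) = 0" using x(2) unfolding \<Phi>_def by simp
    then have "F r x = y r" if "r < N" for r
      using comb[OF that, of "\<lambda>r. F r x - y r"] by (simp add: blinfun.zero_right)
    moreover have "dist x x0 < \<epsilon>" using x(1) \<rho> by (auto simp: S_def dist_commute)
    ultimately show "\<exists>c. dist (x1 + (\<Sum>r<N. c r *\<^sub>R d r)) x0 < \<epsilon> \<and>
        (\<forall>r<N. F r (x1 + (\<Sum>r<N. c r *\<^sub>R d r)) = y r)"
      using xc by (intro exI[of _ c]) simp
  qed
qed

section \<open>Matrices as points of a Banach space\<close>

text \<open>One Banach space that accommodates the matrices of all orders is the space of bounded continuous
  functions on the line: an entry is the value at the natural number that codes its position, and
  the hat function bump p is the matrix unit with position p.\<close>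
definition coord :: "nat \<times> nat \<Rightarrow> real" where
  "coord p = real (prod_encode p)"

definition bump :: "nat \<times> nat \<Rightarrow> (real \<Rightarrow>\<^sub>C real)" where
  "bump p = Bcontfun (\<lambda>z. max 0 (1 - \<bar>z - coord p\<bar>))"

definition coords_mat :: "nat \<Rightarrow> (real \<Rightarrow>\<^sub>C real) \<Rightarrow> real mat" where
  "coords_mat n x = mat n n (\<lambda>p. apply_bcontfun x (coord p))"

definition mat_coords :: "nat \<Rightarrow> (nat \<times> nat \<Rightarrow> real) \<Rightarrow> (real \<Rightarrow>\<^sub>C real)" where
  "mat_coords n g = (\<Sum>p\<in>{..<n} \<times> {..<n}. g p *\<^sub>R bump p)"

lemma apply_bump: "apply_bcontfun (bump p) (coord q) = (if p = q then 1 else 0)"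
proof -
  have "(\<lambda>z. max 0 (1 - \<bar>z - coord p\<bar>)) \<in> bcontfun"
    by (rule bcontfun_normI[where b = 1]) (auto intro!: continuous_intros)
  then have "apply_bcontfun (bump p) (coord q) = max 0 (1 - \<bar>coord q - coord p\<bar>)"
    by (simp add: bump_def Bcontfun_inverse)
  moreover have "\<bar>coord q - coord p\<bar> \<ge> 1" if "p \<noteq> q"
  proof -
    have "prod_encode p \<noteq> prod_encode q" using that by (simp add: prod_encode_eq)
    then show ?thesis unfolding coord_def by linarith
  qed
  ultimately show ?thesis by auto
qed

lemma apply_bcontfun_sum: "apply_bcontfun (\<Sum>i\<in>I. f i) c = (\<Sum>i\<in>I. apply_bcontfun (f i) c)"
  by (induction I rule: infinite_finite_induct) auto

lemma apply_mat_coords: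
  assumes "i < n" "j < n"
  shows "apply_bcontfun (mat_coords n g) (coord (i, j)) = g (i, j)"
proof -
  have "apply_bcontfun (mat_coords n g) (coord (i, j)) =
      (\<Sum>p\<in>{..<n} \<times> {..<n}. if p = (i, j) then g (i, j) else 0)"
    unfolding mat_coords_def apply_bcontfun_sum by (rule sum.cong) (auto simp: apply_bump)
  then show ?thesis using assms by simp
qed

lemma coords_mat_carrier: "coords_mat n x \<in> carrier_mat n n"
  by (simp add: coords_mat_def)

lemma coords_mat_index: "i < n \<Longrightarrow> j < n \<Longrightarrow> coords_mat n x $$ (i, j) = apply_bcontfun x (coord (i, j))"
  by (simp add: coords_mat_def)

lemma bounded_linear_apply_bcontfun: "bounded_linear (\<lambda>x :: real \<Rightarrow>\<^sub>C real. apply_bcontfun x c)"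
  by (rule bounded_linear_intro[where K = 1]) (simp_all add: norm_bounded[where 'b = real, simplified])

lemma C1_fun_coeff_prod:
  fixes P :: "'i \<Rightarrow> 'a::real_normed_vector \<Rightarrow> real poly"
  assumes "\<And>i r. i \<in> I \<Longrightarrow> C1_fun (\<lambda>x. coeff (P i x) r)"
  shows "C1_fun (\<lambda>x. coeff (\<Prod>i\<in>I. P i x) r)"
  using assms
proof (induction I arbitrary: r rule: infinite_finite_induct)
  case (insert i I)
  then show ?case
    by (simp add: coeff_mult) (intro C1_fun_sum C1_fun_mult insert; simp)
qed (auto intro: C1_fun_const)

text \<open>By the Leibniz formula, the coefficients are polynomials in the entries.\<close>
lemma C1_fun_coeff_char_poly:
  fixes M :: "'a::real_normed_vector \<Rightarrow> real mat"
  assumes dim: "\<And>x. M x \<in> carrier_mat n n"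
    and entries: "\<And>i j. i < n \<Longrightarrow> j < n \<Longrightarrow> C1_fun (\<lambda>x. M x $$ (i, j))"
  shows "C1_fun (\<lambda>x. coeff (char_poly (M x)) r)"
proof -
  have entry: "C1_fun (\<lambda>x. coeff (char_poly_matrix (M x) $$ (i, j)) s)" if "i < n" "j < n" for i j s
  proof -
    have eq: "coeff (char_poly_matrix (M x) $$ (i, j)) s =
        coeff (if i = j then [:0, 1:] else 0) s + (if s = 0 then -1 else 0) * M x $$ (i, j)" for x
      using that dim[of x] by (auto simp: char_poly_matrix_def coeff_pCons split: nat.split)
    show ?thesis unfolding eq
      by (intro C1_fun_add C1_fun_mult C1_fun_const entries that)
  qed
  have sgn: "signof p = [:signof p :: real:]" for p :: "nat \<Rightarrow> nat"
    by (cases p rule: sign_cases) (auto simp: one_pCons)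
  have eq: "coeff (char_poly (M x)) r = (\<Sum>p | p permutes {0..<n}.
      signof p * coeff (\<Prod>i = 0..<n. char_poly_matrix (M x) $$ (i, p i)) r)" for x
    unfolding char_poly_def det_def'[OF char_poly_matrix_closed[OF dim]] coeff_sum
    by (subst sgn) simp
  show ?thesis unfolding eq
    by (intro C1_fun_sum C1_fun_mult C1_fun_const C1_fun_coeff_prod entry)
       (auto simp: permutes_in_image atLeast0LessThan)
qed

lemma char_poly_coords_C1:
  "\<exists>f' :: (real \<Rightarrow>\<^sub>C real) \<Rightarrow> (real \<Rightarrow>\<^sub>C real) \<Rightarrow>\<^sub>L real.
     (\<forall>x. ((\<lambda>x. coeff (char_poly (coords_mat n x)) r) has_derivative blinfun_apply (f' x)) (at x)) \<and>
     continuous_on UNIV (\<lambda>x. f' x)"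
proof -
  have "C1_fun (\<lambda>x. coeff (char_poly (coords_mat n x)) r)"
    by (rule C1_fun_coeff_char_poly[OF coords_mat_carrier])
       (simp add: coords_mat_index C1_fun_bounded_linear bounded_linear_apply_bcontfun)
  then show ?thesis unfolding C1_fun_def .
qed

text \<open>A derivative is linear, so it suffices to find its value on the matrix units. Along such a line
  the coefficient is affine, so the slope can be read off.\<close>
lemma char_poly_coords_derivative:
  fixes f' :: "(real \<Rightarrow>\<^sub>C real) \<Rightarrow>\<^sub>L real"
  assumes der: "((\<lambda>x. coeff (char_poly (coords_mat n x)) r) has_derivative blinfun_apply f') (at x)"
  shows "f' (mat_coords n g) =
    coeff (\<Sum>(i, j)\<in>{..<n} \<times> {..<n}. Polynomial.smult (g (i, j)) (entry_deriv (coords_mat n x) i j)) r"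
proof -
  have unit: "f' (bump (i, j)) = coeff (entry_deriv (coords_mat n x) i j) r" if ij: "i < n" "j < n" for i j
  proof -
    have line: "((\<lambda>t. x + t *\<^sub>R bump (i, j)) has_derivative (\<lambda>t. t *\<^sub>R bump (i, j))) (at (0::real))"
      by (auto intro!: derivative_eq_intros)
    have "((\<lambda>x. coeff (char_poly (coords_mat n x)) r) has_derivative blinfun_apply f') (at (x + 0 *\<^sub>R bump (i, j)))"
      using der by simp
    from has_derivative_compose[OF line this]
    have "((\<lambda>t. coeff (char_poly (coords_mat n (x + t *\<^sub>R bump (i, j)))) r) has_derivative
        (\<lambda>t. f' (t *\<^sub>R bump (i, j)))) (at 0)" .
    moreover have "coeff (char_poly (coords_mat n (x + t *\<^sub>R bump (i, j)))) r =
        coeff (char_poly (coords_mat n x)) r + t * coeff (entry_deriv (coords_mat n x) i j) r" for t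
    proof -
      have ent: "coords_mat n (x + t *\<^sub>R bump (i, j)) $$ (k, l) = coords_mat n x $$ (k, l) + (if (k, l) = (i, j) then t else 0)"
        if "k < n" "l < n" for k l
        using that by (simp add: coords_mat_index apply_bump)
      have "char_poly (coords_mat n (x + t *\<^sub>R bump (i, j))) = char_poly (coords_mat n x) +
          Polynomial.smult (coords_mat n (x + t *\<^sub>R bump (i, j)) $$ (i, j) - coords_mat n x $$ (i, j))
            (entry_deriv (coords_mat n x) i j)"
        by (rule char_poly_change_entry[OF coords_mat_carrier coords_mat_carrier ij]) (auto simp: ent)
      then show ?thesis using ij by (simp add: ent)
    qed
    ultimately have "((\<lambda>t. coeff (char_poly (coords_mat n x)) r + t * coeff (entry_deriv (coords_mat n x) i j) r)
        has_derivative (\<lambda>t. f' (t *\<^sub>R bump (i, j)))) (at 0)" by simp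
    moreover have "((\<lambda>t. coeff (char_poly (coords_mat n x)) r + t * coeff (entry_deriv (coords_mat n x) i j) r)
        has_derivative (\<lambda>t. t * coeff (entry_deriv (coords_mat n x) i j) r)) (at 0)"
      by (auto intro!: derivative_eq_intros)
    ultimately have "(\<lambda>t. f' (t *\<^sub>R bump (i, j))) = (\<lambda>t. t * coeff (entry_deriv (coords_mat n x) i j) r)"
      by (rule has_derivative_unique)
    from fun_cong[OF this, of 1] show ?thesis by simp
  qed
  have "f' (mat_coords n g) = (\<Sum>p\<in>{..<n} \<times> {..<n}. g p * f' (bump p))"
    by (simp add: mat_coords_def blinfun.sum_right blinfun.scaleR_right)
  also have "\<dots> = (\<Sum>(i, j)\<in>{..<n} \<times> {..<n}. g (i, j) * coeff (entry_deriv (coords_mat n x) i j) r)"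
    by (rule sum.cong) (auto simp: unit)
  finally show ?thesis by (simp add: coeff_sum case_prod_unfold)
qed

section \<open>Superpatterns of a nilpotent matrix with full-rank Jacobian\<close>

text \<open>Over the complex numbers the characteristic polynomial splits, and every root is an
  eigenvalue, hence 0 for a nilpotent matrix.\<close>
lemma char_poly_nilpotent:
  assumes A: "A \<in> carrier_mat n n" and nil: "nilpotent_mat A"
  shows "char_poly A = monom 1 n"
proof -
  obtain m where m: "A ^\<^sub>m m = 0\<^sub>m n n" using nil A unfolding nilpotent_mat_def by auto
  define C :: "complex mat" where "C = map_mat of_real A"
  have C: "C \<in> carrier_mat n n" using A by (simp add: C_def)
  have "C ^\<^sub>m m = map_mat of_real (A ^\<^sub>m m)"
    unfolding C_def by (rule of_real_hom.mat_hom_pow[OF A, symmetric])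
  then have Cm: "C ^\<^sub>m m = 0\<^sub>m n n" by (auto simp: m)
  obtain as where as: "char_poly C = (\<Prod>a\<leftarrow>as. [:- a, 1:])" "length as = n"
    using char_poly_factorized[OF C] by blast
  have zero: "a = 0" if "a \<in> set as" for a
  proof -
    have "poly (char_poly C) a = 0" unfolding as poly_prod_list using that by (auto simp: prod_list_zero_iff)
    then obtain v where v: "eigenvector C v a"
      using eigenvalue_root_char_poly[OF C] unfolding eigenvalue_def by blast
    then have vc: "v \<in> carrier_vec n" "v \<noteq> 0\<^sub>v n" using C by (auto simp: eigenvector_def)
    have "a ^ m \<cdot>\<^sub>v v = C ^\<^sub>m m *\<^sub>v v" using eigenvector_pow[OF C v] by simp
    also have "\<dots> = 0\<^sub>v n" using vc unfolding Cm by auto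
    finally have z: "a ^ m \<cdot>\<^sub>v v = 0\<^sub>v n" .
    obtain i where i: "i < n" "v $ i \<noteq> 0"
      using vc by (metis eq_vecI carrier_vecD index_zero_vec)
    have "a ^ m * v $ i = (a ^ m \<cdot>\<^sub>v v) $ i" using i vc by simp
    also have "\<dots> = 0" using i by (simp add: z)
    finally show "a = 0" using i by simp
  qed
  have "as = replicate n 0" using zero as(2) by (metis replicate_eqI)
  then have "char_poly C = [:0, 1:] ^ n" unfolding as(1) by simp
  also have "\<dots> = monom 1 n" by (simp add: monom_altdef)
  also have "\<dots> = map_poly of_real (monom 1 n)" by (simp add: map_poly_monom)
  finally have "map_poly of_real (char_poly A) = (map_poly of_real (monom 1 n) :: complex poly)"
    unfolding C_def of_real_hom.char_poly_hom[OF A] .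
  then have "complex_of_real (coeff (char_poly A) r) = complex_of_real (coeff (monom 1 n) r)" for r
    by (metis coeff_map_poly of_real_0)
  then show ?thesis by (intro poly_eqI) (simp only: of_real_eq_iff)
qed

text \<open>The coefficient of z^r is homogeneous of degree n - r in the entries: det(zI - cA) =
  c^n det((z/c)I - A).\<close>
lemma coeff_char_poly_smult:
  fixes A :: "real mat"
  assumes A: "A \<in> carrier_mat n n" and c: "c \<noteq> 0" and r: "r \<le> n"
  shows "coeff (char_poly (c \<cdot>\<^sub>m A)) r = c ^ (n - r) * coeff (char_poly A) r"
proof -
  have cA: "c \<cdot>\<^sub>m A \<in> carrier_mat n n" using A by simp
  have "char_poly (c \<cdot>\<^sub>m A) = Polynomial.smult (c ^ n) (pcompose (char_poly A) [:0, inverse c:])"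
  proof (rule poly_eq_poly_eq_iff[THEN iffD1], rule ext)
    fix z
    have "poly (char_poly (c \<cdot>\<^sub>m A)) z = Determinant.det (- char_matrix (c \<cdot>\<^sub>m A) z)"
      by (rule char_poly_matrix[OF cA])
    also have "- char_matrix (c \<cdot>\<^sub>m A) z = c \<cdot>\<^sub>m (- char_matrix A (inverse c * z))"
      by (rule eq_matI) (use A c in \<open>auto simp: char_matrix_def field_simps\<close>)
    also have "Determinant.det \<dots> = c ^ n * Determinant.det (- char_matrix A (inverse c * z))"
      using A by (simp add: det_smult char_matrix_def)
    also have "Determinant.det (- char_matrix A (inverse c * z)) = poly (char_poly A) (inverse c * z)"
      by (rule char_poly_matrix[OF A, symmetric])
    finally show "poly (char_poly (c \<cdot>\<^sub>m A)) z =
        poly (Polynomial.smult (c ^ n) (pcompose (char_poly A) [:0, inverse c:])) z"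
      by (simp add: poly_pcompose mult.commute)
  qed
  moreover have "coeff (pcompose (char_poly A) [:0, inverse c:]) r = inverse c ^ r * coeff (char_poly A) r"
    by (rule coeff_pcompose_linear)
  moreover have "c ^ n * inverse c ^ r = c ^ (n - r)"
    using r c by (simp add: power_diff field_simps)
  ultimately show ?thesis by (simp add: mult.assoc[symmetric])
qed

text \<open>Start from B, where all lower coefficients of the characteristic polynomial vanish. Give the
  additional positions of T small entries of the required sign, and then move the nonzero entries of B
  slightly, so that their signs survive, until the lower coefficients take any prescribed small
  values. Scaling the matrix by a positive number preserves all signs and turns small values into
  arbitrary ones.\<close>
lemma nilpotent_jacobian_superpattern:
  assumes B: "B \<in> carrier_mat n n" and "n > 0"
    and nil: "nilpotent_mat B" and jac: "allows_full_rank_jacobian B"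
    and super: "superpattern T (sgn_mat B)"
  shows "spectrally_arbitrary T"
proof -
  define F where "F r x = coeff (char_poly (coords_mat n x)) r" for r x
  obtain F' where F': "\<And>r x. (F r has_derivative blinfun_apply (F' r x)) (at x)"
    "\<And>r. continuous_on UNIV (\<lambda>x. F' r x)"
    using char_poly_coords_C1[of n] unfolding F_def by metis
  define x0 where "x0 = mat_coords n (\<lambda>p. B $$ p)"
  have x0: "coords_mat n x0 = B"
    using B by (intro eq_matI) (auto simp: coords_mat_def x0_def apply_mat_coords)
  have F0: "F r x0 = 0" if "r < n" for r
    using that by (simp add: F_def x0 char_poly_nilpotent[OF B nil])
  define direction where "direction r D \<longleftrightarrow> (\<forall>p. B $$ p = 0 \<longrightarrow> D p = 0) \<and>
      monom 1 r = (\<Sum>(i, j)\<in>{..<n} \<times> {..<n}. Polynomial.smult (D (i, j)) (entry_deriv B i j))" for r D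
  have "\<exists>D. direction r D" if "r < n" for r
  proof -
    have "degree (monom (1 :: real) r) < n" using that by (simp add: degree_monom_eq)
    then have "reachable B (monom 1 r)" using jac allows_full_rank_jacobian_iff[OF B \<open>n > 0\<close>] by blast
    then show ?thesis unfolding reachable_def direction_def carrier_matD(1)[OF B] .
  qed
  then obtain D where "\<And>r. r < n \<Longrightarrow> direction r (D r)" by metis
  then have D0: "\<And>r p. r < n \<Longrightarrow> B $$ p = 0 \<Longrightarrow> D r p = 0"
    and D: "\<And>r. r < n \<Longrightarrow> monom 1 r =
      (\<Sum>(i, j)\<in>{..<n} \<times> {..<n}. Polynomial.smult (D r (i, j)) (entry_deriv B i j))"
    unfolding direction_def by blast+
  define d where "d r = mat_coords n (D r)" for r
  have dual: "F' r x0 (d s) = (if r = s then 1 else 0)" if "r < n" "s < n" for r s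
  proof -
    have "F' r x0 (d s) = coeff (monom 1 s) r"
      unfolding d_def D[OF that(2)]
      using char_poly_coords_derivative[OF F'(1)[unfolded F_def[abs_def], of r x0], of "D s"]
      unfolding x0 .
    then show ?thesis by simp
  qed
  \<comment> \<open>Changes smaller than every nonzero entry of B keep the signs of these entries.\<close>
  define \<epsilon> where "\<epsilon> = Min (insert 1 ((\<lambda>p. \<bar>B $$ p\<bar>) ` {p \<in> {..<n} \<times> {..<n}. B $$ p \<noteq> 0}))"
  have "\<epsilon> > 0" unfolding \<epsilon>_def by (subst Min_gr_iff) auto
  have \<epsilon>_le: "\<epsilon> \<le> \<bar>B $$ (i, j)\<bar>" if "i < n" "j < n" "B $$ (i, j) \<noteq> 0" for i j
    unfolding \<epsilon>_def using that by (intro Min_le) auto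
  have "\<exists>\<delta>>0. \<forall>x1 y. dist x1 x0 < \<delta> \<and> (\<forall>r<n. \<bar>y r - F r x0\<bar> < \<delta>) \<longrightarrow>
    (\<exists>c. dist (x1 + (\<Sum>r<n. c r *\<^sub>R d r)) x0 < \<epsilon> \<and> (\<forall>r<n. F r (x1 + (\<Sum>r<n. c r *\<^sub>R d r)) = y r))"
    by (rule local_solvability[OF F'(1) F'(2) dual \<open>\<epsilon> > 0\<close>])
  then obtain \<delta> where "\<delta> > 0" and solve: "\<And>x1 y. dist x1 x0 < \<delta> \<Longrightarrow> \<forall>r<n. \<bar>y r - F r x0\<bar> < \<delta> \<Longrightarrow>
    \<exists>c. dist (x1 + (\<Sum>r<n. c r *\<^sub>R d r)) x0 < \<epsilon> \<and> (\<forall>r<n. F r (x1 + (\<Sum>r<n. c r *\<^sub>R d r)) = y r)"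
    by blast
  have T: "T \<in> carrier_mat n n" using super B by (auto simp: superpattern_def sgn_mat_def)
  have T_eq: "T $$ (i, j) = sign_of (B $$ (i, j))" if "i < n" "j < n" "B $$ (i, j) \<noteq> 0" for i j
  proof -
    have "sgn_mat B $$ (i, j) = sign_of (B $$ (i, j))" using that B by (simp add: sgn_mat_def)
    moreover have "sign_of (B $$ (i, j)) \<noteq> SZero" using that(3) by (simp add: sign_of_def)
    ultimately show ?thesis using super that B unfolding superpattern_def by (auto simp: sgn_mat_def)
  qed
  define val where "val \<sigma> = (case \<sigma> of SZero \<Rightarrow> 0 | SPos \<Rightarrow> 1 | SNeg \<Rightarrow> (-1 :: real))" for \<sigma>
  define w where "w = mat_coords n (\<lambda>p. if B $$ p = 0 then val (T $$ p) else 0)"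
  define t where "t = \<delta> / (2 * (norm w + 1))"
  have "t > 0" using \<open>\<delta> > 0\<close> by (auto simp: t_def intro!: divide_pos_pos add_nonneg_pos)
  have "t * (norm w + 1) = \<delta> / 2" unfolding t_def by (simp add: field_simps add_nonneg_eq_0_iff)
  then have tw: "t * norm w < \<delta>" using \<open>t > 0\<close> \<open>\<delta> > 0\<close> by (simp add: distrib_left)
  \<comment> \<open>The entries at the zero positions of B are set here once and for all: the directions d r
    do not touch them.\<close>
  define x1 where "x1 = x0 + t *\<^sub>R w"
  have x1: "dist x1 x0 < \<delta>" using tw \<open>t > 0\<close> by (simp add: x1_def dist_norm)
  have "\<exists>A\<in>qual_class T. char_poly A = p" if p: "monic p" "degree p = n" for p
  proof -
    define M where "M = (\<Sum>r<n. \<bar>coeff p r\<bar>)"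
    have "M \<ge> 0" by (simp add: M_def sum_nonneg)
    \<comment> \<open>Scaling by s brings all lower coefficients of p below the threshold for local solvability;
      s is at most 1, so that its powers are at most s.\<close>
    define s where "s = min 1 (\<delta> / (2 * (M + 1)))"
    have s: "s > 0" "s \<le> 1" using \<open>\<delta> > 0\<close> \<open>M \<ge> 0\<close> by (auto simp: s_def)
    have "s * (M + 1) \<le> \<delta> / (2 * (M + 1)) * (M + 1)"
      using \<open>M \<ge> 0\<close> by (intro mult_right_mono) (auto simp: s_def)
    also have "\<dots> = \<delta> / 2" using \<open>M \<ge> 0\<close> by (simp add: field_simps)
    finally have sM: "s * M < \<delta>" using s \<open>\<delta> > 0\<close> by (simp add: distrib_left)
    define y where "y r = s ^ (n - r) * coeff p r" for r
    have y: "\<bar>y r - F r x0\<bar> < \<delta>" if "r < n" for r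
    proof -
      have "\<bar>y r\<bar> = s ^ (n - r) * \<bar>coeff p r\<bar>" using s by (simp add: y_def abs_mult)
      also have "\<dots> \<le> s * M"
      proof (rule mult_mono)
        show "s ^ (n - r) \<le> s" using power_decreasing[of 1 "n - r" s] s that by simp
        show "\<bar>coeff p r\<bar> \<le> M" unfolding M_def using that by (intro member_le_sum) auto
      qed (use s in auto)
      finally show ?thesis using sM F0[OF that] by simp
    qed
    obtain c where c: "dist (x1 + (\<Sum>r<n. c r *\<^sub>R d r)) x0 < \<epsilon>"
      "\<And>r. r < n \<Longrightarrow> F r (x1 + (\<Sum>r<n. c r *\<^sub>R d r)) = y r"
      using solve[OF x1, of y] y by blast
    define x where "x = x1 + (\<Sum>r<n. c r *\<^sub>R d r)"
    define X where "X = coords_mat n x"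
    have X: "X \<in> carrier_mat n n" by (simp add: X_def coords_mat_carrier)
    have sign: "has_sign (X $$ (i, j)) (T $$ (i, j))" if ij: "i < n" "j < n" for i j
    proof (cases "B $$ (i, j) = 0")
      case True
      have "X $$ (i, j) = t * val (T $$ (i, j))"
        using ij True D0
        by (simp add: X_def coords_mat_index x_def x1_def x0_def w_def d_def apply_bcontfun_sum apply_mat_coords)
      then show ?thesis using \<open>t > 0\<close> by (cases "T $$ (i, j)") (auto simp: val_def)
    next
      case False
      have "\<bar>X $$ (i, j) - B $$ (i, j)\<bar> = dist (apply_bcontfun x (coord (i, j))) (apply_bcontfun x0 (coord (i, j)))"
        using ij by (simp add: X_def coords_mat_index x0_def apply_mat_coords dist_real_def)
      also have "\<dots> \<le> dist x x0" by (rule dist_bounded)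
      also have "\<dots> < \<bar>B $$ (i, j)\<bar>" using c(1) \<epsilon>_le[OF ij False] by (simp add: x_def)
      finally have "\<bar>X $$ (i, j) - B $$ (i, j)\<bar> < \<bar>B $$ (i, j)\<bar>" .
      then show ?thesis using False unfolding T_eq[OF ij False] by (auto simp: sign_of_def abs_if split: if_splits)
    qed
    define A where "A = inverse s \<cdot>\<^sub>m X"
    have A: "A \<in> carrier_mat n n" using X by (simp add: A_def)
    have "char_poly A = p"
    proof (rule poly_eqI)
      fix r
      consider "r < n" | "r = n" | "r > n" by linarith
      then show "coeff (char_poly A) r = coeff p r"
      proof cases
        case 1
        have "coeff (char_poly A) r = inverse s ^ (n - r) * coeff (char_poly X) r"
          unfolding A_def using s 1 by (intro coeff_char_poly_smult[OF X]) auto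
        also have "coeff (char_poly X) r = s ^ (n - r) * coeff p r"
          using c(2)[OF 1] by (simp add: F_def X_def x_def y_def)
        also have "inverse s ^ (n - r) * (s ^ (n - r) * coeff p r) = coeff p r"
          using s by (simp add: power_inverse)
        finally show ?thesis .
      next
        case 2
        then show ?thesis using degree_monic_char_poly[OF A] p by simp
      next
        case 3
        then show ?thesis using degree_monic_char_poly[OF A] p by (simp add: coeff_eq_0)
      qed
    qed
    moreover have "A \<in> qual_class T"
    proof -
      have "has_sign (A $$ (i, j)) (T $$ (i, j))" if "i < n" "j < n" for i j
        using sign[OF that] s that X
        by (cases "T $$ (i, j)") (auto simp: A_def zero_less_mult_iff mult_less_0_iff)
      then show ?thesis using A T by (auto simp: qual_class_def)
    qed
    ultimately show ?thesis by blast
  qed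
  then show ?thesis using T by (auto simp: spectrally_arbitrary_def)
qed

section \<open>Bordering preserves the nilpotent-Jacobian property\<close>

theorem theorem2p1:
  fixes n k v :: nat and S :: sign_pattern and A B :: "real mat"
  assumes "S \<in> carrier_mat n n"
    and "A \<in> qual_class S"
    and "nilpotent_mat A"
    and "allows_full_rank_jacobian A"
    and "k < n" and "v < n" and "v \<noteq> k"
    and "A $$ (k, k) \<noteq> 0"
    and "A $$ (k, v) \<noteq> 0"
    and "Determinant.det (mat_delete A k v) \<noteq> 0"
    and "B = bordered_mat n k A"
  shows "B \<in> carrier_mat (n + 1) (n + 1) \<and> nilpotent_mat B \<and> allows_full_rank_jacobian B \<and>
         (\<forall>T. superpattern T (sgn_mat B) \<longrightarrow> spectrally_arbitrary T)"
proof -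
  have A: "A \<in> carrier_mat n n" using assms(1,2) by (auto simp: qual_class_def)
  have B: "B \<in> carrier_mat (n + 1) (n + 1)" unfolding assms(11) by (rule bordered_mat_carrier[OF A])
  have nil: "nilpotent_mat B" unfolding assms(11) by (rule nilpotent_bordered_mat[OF A assms(5,3)])
  have jac: "allows_full_rank_jacobian B" unfolding assms(11)
    by (rule full_rank_jacobian_bordered[OF A assms(5-7,4,8-10)])
  show ?thesis using B nil jac nilpotent_jacobian_superpattern[OF B _ nil jac] by simp
qed

end
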